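(* Let $\tau\in\mathbb{C}$ with $\operatorname{Im}\tau>0$, let $\sigma(z)=\sigma(z|1,\tau)$ be the Weierstrass $\sigma$-function of the lattice $\Omega=\{m+n\tau: m,n\in\mathbb{Z}\}$, let $\zeta=\sigma'/\sigma$ and $\eta_1=2\zeta(1/2)$. Suppose that $$\operatorname{Re}\left(\frac{1}{\eta_1}\right)\ge \frac{\operatorname{Im}\tau}{2\pi}.$$ Then $\operatorname{area}(J(\sigma)\cap A(\sigma))>0$.
   Context: The Weierstrass $\sigma$-function of the lattice $\Omega=\{m\omega_1+n\omega_2: m,n\in\mathbb{Z}\}$ (here $\omega_1=1$, $\omega_2=\tau$) is the entire function $$\sigma(z)=\sigma(z|\omega_1,\omega_2)=z\prod_{w\in\Omega\setminus\{0\}}\left(1-\frac{z}{w}\right)\exp\left(\frac{z}{w}+\frac12\left(\frac{z}{w}\right)^2\right),$$ and the Weierstrass $\zeta$-function is $\zeta(z)=\sigma'(z)/\sigma(z)$. For a transcendental entire function $f$, $f^n$ denotes the $n$-th iterate. The Julia set $J(f)$ is the complement in $\mathbb{C}$ of the set of points at which the iterates $f^n$ form a normal family. Let $M(r,f)=\max_{|z|=r}|f(z)|$, $M^1(r,f)=M(r,f)$ and $M^n(r,f)=M(M^{n-1}(r,f),f)$ for $n\ge 2$. There exists $R>0$ such that $M(r,f)>r$ for all $r\ge R$; with such an $R$, the fast escaping set $A(f)$ is the set of all $z\in\mathbb{C}$ for which there exists $L\in\mathbb{N}$ such that $|f^n(z)|\ge M^{n-L}(R,f)$ for all $n>L$.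 (The definition is independent of the choice of $R$.) $\operatorname{area}$ denotes two-dimensional Lebesgue measure. *)

theory Defs
  imports "HOL-Complex_Analysis.Complex_Analysis"
begin

definition period_lattice :: "complex \<Rightarrow> complex \<Rightarrow> complex set" where
  "period_lattice \<omega>1 \<omega>2 = {of_int m * \<omega>1 + of_int n * \<omega>2 | m n :: int. True}"

(* The product over the lattice is the unordered one: the limit of the finite
   partial products along the net of finite subsets of the punctured lattice,
   just as infsum is defined for sums.  For periods linearly independent over
   the reals the product converges absolutely, hence unconditionally. *)
definition weierstrass_sigma :: "complex \<Rightarrow> complex \<Rightarrow> complex \<Rightarrow> complex" where
  "weierstrass_sigma \<omega>1 \<omega>2 z =
     z * Lim (finite_subsets_at_top (period_lattice \<omega>1 \<omega>2 - {0}))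
           (\<lambda>W. \<Prod>w\<in>W. (1 - z / w) * exp (z / w + 1 / 2 * (z / w)\<^sup>2))"

definition weierstrass_zeta :: "complex \<Rightarrow> complex \<Rightarrow> complex \<Rightarrow> complex" where
  "weierstrass_zeta \<omega>1 \<omega>2 z = deriv (weierstrass_sigma \<omega>1 \<omega>2) z / weierstrass_sigma \<omega>1 \<omega>2 z"

(* Normality in the sense of Montel for families of holomorphic functions on a
   domain U, with the constant limit infinity allowed, i.e. normality for maps
   into the Riemann sphere. *)
definition normal_family_on :: "(complex \<Rightarrow> complex) set \<Rightarrow> complex set \<Rightarrow> bool" where
  "normal_family_on F U \<longleftrightarrow>
     (\<forall>g :: nat \<Rightarrow> complex \<Rightarrow> complex. (\<forall>n. g n \<in> F) \<longrightarrow>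
        (\<exists>r :: nat \<Rightarrow> nat. strict_mono r \<and>
           ((\<exists>h. \<forall>K. compact K \<and> K \<subseteq> U \<longrightarrow> uniform_limit K (g \<circ> r) h sequentially) \<or>
            (\<forall>K. compact K \<and> K \<subseteq> U \<longrightarrow>
               (\<forall>B. \<forall>\<^sub>F n in sequentially. \<forall>z\<in>K. B \<le> cmod ((g \<circ> r) n z))))))"

definition julia_set :: "(complex \<Rightarrow> complex) \<Rightarrow> complex set" where
  "julia_set f = - {z. \<exists>U. open U \<and> connected U \<and> z \<in> U \<and>
                          normal_family_on (range (\<lambda>n::nat. f ^^ n)) U}"

definition max_modulus :: "(complex \<Rightarrow> complex) \<Rightarrow> real \<Rightarrow> real" where
  "max_modulus f r = (SUP z\<in>sphere 0 r. cmod (f z))"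

definition admissible_radius :: "(complex \<Rightarrow> complex) \<Rightarrow> real \<Rightarrow> bool" where
  "admissible_radius f R \<longleftrightarrow> R > 0 \<and> (\<forall>r\<ge>R. max_modulus f r > r)"

definition fast_escaping_set_from :: "(complex \<Rightarrow> complex) \<Rightarrow> real \<Rightarrow> complex set" where
  "fast_escaping_set_from f R =
     {z. \<exists>L::nat. \<forall>n>L. cmod ((f ^^ n) z) \<ge> (max_modulus f ^^ (n - L)) R}"

(* The choice of R is immaterial, see fast_escaping_set_eq below. *)
definition fast_escaping_set :: "(complex \<Rightarrow> complex) \<Rightarrow> complex set" where
  "fast_escaping_set f = (\<Union>R\<in>Collect (admissible_radius f). fast_escaping_set_from f R)"

context
  fixes f :: "complex \<Rightarrow> complex"
  assumes entire: "f holomorphic_on UNIV"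
begin

lemma cmod_le_max_modulus:
  assumes "cmod z \<le> r"
  shows "cmod (f z) \<le> max_modulus f r"
proof -
  have bdd: "bdd_above ((\<lambda>z. cmod (f z)) ` sphere 0 r)"
    by (intro bounded_imp_bdd_above compact_imp_bounded compact_continuous_image
          continuous_intros holomorphic_on_imp_continuous_on holomorphic_on_subset[OF entire]) auto
  have le: "cmod (f w) \<le> max_modulus f r" if "w \<in> sphere 0 r" for w
    unfolding max_modulus_def using that by (intro cSUP_upper bdd)
  show ?thesis
  proof (rule maximum_modulus_frontier[of f "cball 0 r"])
    show "f holomorphic_on interior (cball 0 r)"
      using entire holomorphic_on_subset by blast
    show "continuous_on (closure (cball 0 r)) f"
      using entire holomorphic_on_imp_continuous_on holomorphic_on_subset by blast
    show "cmod (f w) \<le> max_modulus f r" if "w \<in> frontier (cball 0 r)" for w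
      using le[of w] that by (cases "r > 0") (auto simp: frontier_def split: if_splits)
  qed (use assms in auto)
qed

lemma max_modulus_attained:
  assumes "r \<ge> 0"
  obtains z where "cmod z = r" "max_modulus f r = cmod (f z)"
proof -
  have "continuous_on (sphere 0 r) (\<lambda>z. cmod (f z))"
    by (intro continuous_intros holomorphic_on_imp_continuous_on holomorphic_on_subset[OF entire]) auto
  moreover have "sphere (0::complex) r \<noteq> {}" using assms by simp
  ultimately obtain z where z: "z \<in> sphere 0 r" "\<And>w. w \<in> sphere 0 r \<Longrightarrow> cmod (f w) \<le> cmod (f z)"
    using continuous_attains_sup[of "sphere (0::complex) r" "\<lambda>z. cmod (f z)"] by auto
  have "max_modulus f r = cmod (f z)"
    unfolding max_modulus_def by (rule cSup_eq_maximum) (use z in auto)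
  with z(1) that show ?thesis by auto
qed

lemma max_modulus_mono:
  assumes "0 \<le> r" "r \<le> s"
  shows "max_modulus f r \<le> max_modulus f s"
  using max_modulus_attained[OF assms(1)] cmod_le_max_modulus assms(2) by metis

lemma max_modulus_iterate_ge:
  assumes "admissible_radius f R"
  shows "R \<le> (max_modulus f ^^ k) R" "(max_modulus f ^^ k) R \<le> (max_modulus f ^^ Suc k) R"
proof -
  show *: "R \<le> (max_modulus f ^^ k) R" for k
    using assms by (induction k) (auto simp: admissible_radius_def intro: less_imp_le le_less_trans)
  show "(max_modulus f ^^ k) R \<le> (max_modulus f ^^ Suc k) R"
    using assms *[of k] by (auto simp: admissible_radius_def intro: less_imp_le)
qed

lemma max_modulus_iterate_mono:
  assumes "admissible_radius f R" "R \<le> S"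
  shows "(max_modulus f ^^ k) R \<le> (max_modulus f ^^ k) S"
proof (induction k)
  case (Suc k)
  have "0 \<le> (max_modulus f ^^ k) R"
    using max_modulus_iterate_ge(1)[OF assms(1), of k] assms(1) by (auto simp: admissible_radius_def)
  with Suc show ?case by (auto intro: max_modulus_mono)
qed (use assms in auto)

lemma max_modulus_iterate_unbounded:
  assumes "admissible_radius f R"
  obtains k where "S \<le> (max_modulus f ^^ k) R"
proof (rule ccontr)
  assume "\<not> thesis"
  define a where "a k = (max_modulus f ^^ k) R" for k
  have bdd: "a k \<le> S" for k
    using \<open>\<not> thesis\<close> that unfolding a_def by (meson linear)
  have inc: "incseq a"
    unfolding a_def by (intro incseq_SucI max_modulus_iterate_ge(2) assms)
  obtain l where l: "a \<longlonglongrightarrow> l" "\<And>k. a k \<le> l"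
    using incseq_convergent[OF inc, of S] bdd by blast
  have "R \<le> l" using l(2)[of 0] by (simp add: a_def)
  hence pos: "l > 0" and gt: "max_modulus f l > l"
    using assms by (auto simp: admissible_radius_def)
  obtain z where z: "cmod z = l" "max_modulus f l = cmod (f z)"
    using max_modulus_attained[of l] pos by auto
  have apos: "a k > 0" for k
    using max_modulus_iterate_ge(1)[OF assms, of k] assms by (auto simp: a_def admissible_radius_def)
  have "isCont f z"
    using holomorphic_on_imp_continuous_on[OF entire] by (simp add: continuous_on_eq_continuous_at)
  moreover have "(\<lambda>k. of_real (a k / l) * z) \<longlonglongrightarrow> of_real (l / l) * z"
    using pos by (intro tendsto_intros l(1)) auto
  hence "(\<lambda>k. of_real (a k / l) * z) \<longlonglongrightarrow> z" using pos by simp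
  ultimately have lim: "(\<lambda>k. cmod (f (of_real (a k / l) * z))) \<longlonglongrightarrow> cmod (f z)"
    by (intro tendsto_norm) (rule isCont_tendsto_compose)
  have "cmod (f (of_real (a k / l) * z)) \<le> l" for k
  proof -
    have "cmod (of_real (a k / l) * z) = a k"
      using pos z(1) apos[of k] by (simp add: norm_mult norm_divide)
    hence "cmod (f (of_real (a k / l) * z)) \<le> max_modulus f (a k)"
      by (intro cmod_le_max_modulus) simp
    also have "\<dots> = a (Suc k)" by (simp add: a_def)
    also have "\<dots> \<le> l" by (rule l(2))
    finally show ?thesis .
  qed
  hence "cmod (f z) \<le> l"
    by (intro tendsto_upperbound[OF lim]) auto
  with gt z(2) show False by simp
qed

lemma fast_escaping_set_from_subset:
  assumes R: "admissible_radius f R" and S: "admissible_radius f S"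
  shows "fast_escaping_set_from f R \<subseteq> fast_escaping_set_from f S"
proof
  fix z assume "z \<in> fast_escaping_set_from f R"
  then obtain L where L: "\<And>n. n > L \<Longrightarrow> (max_modulus f ^^ (n - L)) R \<le> cmod ((f ^^ n) z)"
    by (auto simp: fast_escaping_set_from_def)
  obtain k where k: "S \<le> (max_modulus f ^^ k) R"
    using max_modulus_iterate_unbounded[OF R] .
  have "(max_modulus f ^^ (n - (L + k))) S \<le> cmod ((f ^^ n) z)" if "n > L + k" for n
  proof -
    have "(max_modulus f ^^ (n - (L + k))) S \<le>
          (max_modulus f ^^ (n - (L + k))) ((max_modulus f ^^ k) R)"
      by (rule max_modulus_iterate_mono[OF S k])
    also have "\<dots> = (max_modulus f ^^ (n - (L + k) + k)) R"
      by (simp add: funpow_add)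
    also have "n - (L + k) + k = n - L" using that by simp
    also have "(max_modulus f ^^ (n - L)) R \<le> cmod ((f ^^ n) z)" using that by (intro L) simp
    finally show ?thesis .
  qed
  thus "z \<in> fast_escaping_set_from f S"
    by (auto simp: fast_escaping_set_from_def)
qed

theorem fast_escaping_set_eq:
  assumes "admissible_radius f R"
  shows "fast_escaping_set f = fast_escaping_set_from f R"
  using fast_escaping_set_from_subset assms unfolding fast_escaping_set_def by blast

end

end

theory Submission
  imports Defs "HOL-Real_Asymp.Real_Asymp"
begin

text \<open>
  Write \<sigma> for the Weierstrass function of the lattice \<Lambda> spanned by 1 and \<tau>. Quasi-periodicity
  means that |\<sigma>(z)| = exp(Q(z)) P(z), where P is \<Lambda>-periodic and vanishes exactly on \<Lambda>, to first
  order, and Q(z) = (a |z|^2 + Re(\<gamma> z^2)) / 2 is a real quadratic form with a = \<pi> N / Im \<tau> for some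
  integer N and \<gamma> = \<eta>1 - a. Comparing shifts by 1 and \<tau> shows that N is an integer, and N is positive by
  Liouville's theorem: for N \<le> 0 the entire function \<sigma>(z) exp(-\<gamma> z^2 / 2) would be bounded. The
  hypothesis on Re(1 / \<eta>1) describes, in the variable \<eta>1, the closed disc of centre and radius \<pi> / Im \<tau> without 0;
  it implies |\<gamma>| \<le> a, which says that Q is positive semidefinite. For a suitable unit v one has
  Q(z) \<ge> (a / 2) Re(v z)^2, so that Q is large away from a single line.
  
  Call z bad if it is within |z|^(1/2) of that line (Re(v z)^2 < |z|) or within |z|^(-1/4) of a lattice
  point. At a point y that is not bad and not small, |\<sigma>(y)| \<ge> exp(a |y| / 4) and |\<sigma>'(y)| \<ge> |\<sigma>(y)|, and \<sigma>
  expands distances by at least |\<sigma>(y)| / 2 on the disc of radius |y|^(-3)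
  (lemma good_point_estimates). Two crude area estimates carry the proof.
  
  \<^item> The bad points with 2^k \<le> |z| < 2^(k+1) have area O(2^(3 k / 2)) (lemma bad_area).
  
  \<^item> If E lies in this annulus, the good points y with \<sigma>(y) \<in> E have |y| = O(k). They are covered by
  O(k^8) squares that are small enough for the local expansion, and on each of them \<sigma> expands by
  2^(k-1). So their area is at most O(k^8 4^(-k)) area(E), which is below 2^(-7 k / 4) area(E) for large
  k (lemma pull_shell).
  
  In particular taking good preimages never increases area, and the good preimage of the bad points of
  modulus at least 2^k has area O(2^(-k / 4)). As moduli at least double along a good orbit, the points of
  the annulus 2^j \<le> |z| < 2^(j+1) whose orbit becomes bad at some time n \<ge> 1 have bounded total area,
  uniformly in j; those that are bad at time 0 have area O(2^(3 j / 2)). The annulus has area at least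
  4^j / 4, so for large j a set of positive area has orbits that are never bad
  (lemma persistent_positive).
  
  Along such an orbit the moduli satisfy |\<sigma>(y)| \<ge> exp(a |y| / 4), whereas the maximum modulus of \<sigma> is at most
  C exp(a r^2). Both are single exponentials of powers, so the orbit escapes fast. The derivatives of
  the iterates tend to infinity along the orbit, so by Bloch's theorem the n-th iterate maps any fixed
  neighbourhood of the starting point onto a set containing a large disc, hence a lattice point; the
  next iterate then takes the value 0. This contradicts normality, because the limit function could only
  be infinity. So the starting point lies in the Julia set.
\<close>

section \<open>Unordered infinite products\<close>

text \<open>
  The estimate |\<Prod>(1 + u) - 1| \<le> exp(\<Sum>|u|) - 1 for finite products bounds the effect of any finite set
  of factors outside an initial segment by the tail of \<Sum>|u|. This links the
  unordered limit that defines \<sigma> with products over an enumeration.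
\<close>
lemma prod_tendsto_prodinf_finite_subsets:
  fixes g :: "nat \<Rightarrow> complex"
  assumes "abs_convergent_prod g"
  shows "(prod g \<longlongrightarrow> prodinf g) (finite_subsets_at_top UNIV)"
proof -
  define u where "u n = norm (g n - 1)" for n
  have u: "summable u" and u0: "\<And>n. u n \<ge> 0"
    using assms unfolding abs_convergent_prod_conv_summable u_def by simp_all
  define S where "S = suminf u"
  have sum_le: "sum u W \<le> S" if "finite W" for W
    unfolding S_def by (intro sum_le_suminf u that) (auto simp: u0)
  have prod_le: "prod (\<lambda>n. 1 + u n) W \<le> exp (sum u W)" if "finite W" for W
    using that by (simp add: exp_sum) (intro prod_mono, auto simp: u0 add_nonneg_nonneg)
  have lim: "(\<lambda>N. \<Prod>n<N. g n) \<longlonglongrightarrow> prodinf g"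
    using convergent_prod_LIMSEQ[OF abs_convergent_prod_imp_convergent_prod[OF assms]]
    by (simp add: LIMSEQ_lessThan_iff_atMost)
  have tail: "(\<lambda>N. exp S * (exp (S - (\<Sum>n<N. u n)) - 1)) \<longlonglongrightarrow> exp S * (exp (S - S) - 1)"
    unfolding S_def by (intro tendsto_intros summable_LIMSEQ u)
  show ?thesis
  proof (rule tendstoI)
    fix e :: real assume e: "e > 0"
    have "eventually (\<lambda>N. dist (\<Prod>n<N. g n) (prodinf g) < e/2) sequentially"
      using lim e by (intro tendstoD) auto
    moreover have "eventually (\<lambda>N. exp S * (exp (S - (\<Sum>n<N. u n)) - 1) < e/2) sequentially"
      using e by (intro order_tendstoD(2)[OF tail]) auto
    ultimately have "eventually (\<lambda>N. dist (\<Prod>n<N. g n) (prodinf g) < e/2 \<and>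
        exp S * (exp (S - (\<Sum>n<N. u n)) - 1) < e/2) sequentially"
      by (rule eventually_conj)
    then obtain N where N: "dist (\<Prod>n<N. g n) (prodinf g) < e/2"
        "exp S * (exp (S - (\<Sum>n<N. u n)) - 1) < e/2"
      using eventually_happens'[OF sequentially_bot] by blast
    show "eventually (\<lambda>W. dist (prod g W) (prodinf g) < e) (finite_subsets_at_top UNIV)"
      unfolding eventually_finite_subsets_at_top
    proof (intro exI conjI allI impI)
      fix W :: "nat set" assume W: "finite W \<and> {..<N} \<subseteq> W \<and> W \<subseteq> UNIV"
      have *: "prod g W = (\<Prod>n<N. g n) * prod g (W - {..<N})"
        using W by (metis finite_lessThan prod.subset_diff mult.commute)
      have "norm (prod g (W - {..<N}) - 1) \<le> (\<Prod>n\<in>W - {..<N}. 1 + u n) - 1"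
        using norm_prod_minus1_le_prod_minus1[of "\<lambda>n. g n - 1" "W - {..<N}"] by (simp add: u_def)
      also have "\<dots> \<le> exp (sum u (W - {..<N})) - 1"
        using prod_le[of "W - {..<N}"] W by auto
      also have "sum u (W - {..<N}) = sum u W - (\<Sum>n<N. u n)"
        using W by (intro sum_diff) auto
      also have "exp (sum u W - (\<Sum>n<N. u n)) \<le> exp (S - (\<Sum>n<N. u n))"
        using sum_le[of W] W by simp
      finally have 1: "norm (prod g (W - {..<N}) - 1) \<le> exp (S - (\<Sum>n<N. u n)) - 1" by simp
      have "norm (\<Prod>n<N. g n) \<le> (\<Prod>n<N. 1 + u n)"
        unfolding prod_norm[symmetric]
        by (intro prod_mono) (use norm_triangle_ineq[of 1 "g _ - 1"] in \<open>auto simp: u_def\<close>)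
      also have "\<dots> \<le> exp (\<Sum>n<N. u n)" by (rule prod_le) simp
      also have "\<dots> \<le> exp S" using sum_le[of "{..<N}"] by simp
      finally have 2: "norm (\<Prod>n<N. g n) \<le> exp S" .
      have "dist (prod g W) (\<Prod>n<N. g n) = norm (\<Prod>n<N. g n) * norm (prod g (W - {..<N}) - 1)"
        unfolding * dist_norm by (simp add: norm_mult[symmetric] algebra_simps)
      also have "\<dots> \<le> exp S * (exp (S - (\<Sum>n<N. u n)) - 1)"
        by (intro mult_mono 1 2) auto
      also have "\<dots> < e/2" by (rule N)
      finally show "dist (prod g W) (prodinf g) < e"
        using N(1) dist_triangle_half_l[of _ "\<Prod>n<N. g n" e] by (metis dist_commute)
    qed auto
  qed
qed

section \<open>The lattice and its Weierstrass product\<close>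

lemma inverse_abs_powr_summable_on_int:
  "(\<lambda>m::int. (1 + \<bar>real_of_int m\<bar>) powr (-3/2)) summable_on UNIV"
proof -
  let ?f = "\<lambda>m::int. (1 + \<bar>real_of_int m\<bar>) powr (-3/2)"
  have "summable (\<lambda>n. real n powr (-3/2))"
    by (simp add: summable_real_powr_iff)
  then have "summable (\<lambda>n. real (Suc n) powr (-3/2))"
    by (subst summable_Suc_iff)
  then have "(\<lambda>n. real (Suc n) powr (-3/2)) summable_on UNIV"
    by (intro norm_summable_imp_summable_on) auto
  then have 1: "?f summable_on range int" "?f summable_on range (\<lambda>n. - int n)"
    by (subst summable_on_reindex; auto simp: inj_on_def o_def)+
  have "(UNIV::int set) = range int \<union> range (\<lambda>n. - int n)"
  proof -
    have "x \<in> range int \<union> range (\<lambda>n. - int n)" for x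
      by (cases x rule: int_cases2) auto
    then show ?thesis by blast
  qed
  with 1 show ?thesis by (metis summable_on_union)
qed

locale lattice =
  fixes \<tau> :: complex
  assumes Im_tau: "Im \<tau> > 0"
begin

definition \<Lambda> :: "complex set" where "\<Lambda> = period_lattice 1 \<tau>"

lemma lattice_eq: "\<Lambda> = range (\<lambda>(m, n). of_int m + of_int n * \<tau>)"
  by (auto simp: \<Lambda>_def period_lattice_def image_iff)

lemma latticeI [intro]: "of_int m + of_int n * \<tau> \<in> \<Lambda>"
  by (auto simp: lattice_eq image_iff)

lemma latticeE:
  assumes "w \<in> \<Lambda>" obtains m n where "w = of_int m + of_int n * \<tau>"
  using assms by (auto simp: lattice_eq)

lemma zero_in_lattice [simp]: "0 \<in> \<Lambda>" and one_in_lattice [simp]: "1 \<in> \<Lambda>"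
  and tau_in_lattice [simp]: "\<tau> \<in> \<Lambda>"
  using latticeI[of 0 0] latticeI[of 1 0] latticeI[of 0 1] by auto

lemma lattice_add: "x \<in> \<Lambda> \<Longrightarrow> y \<in> \<Lambda> \<Longrightarrow> x + y \<in> \<Lambda>"
proof (elim latticeE)
  fix m n k l assume "x = of_int m + of_int n * \<tau>" "y = of_int k + of_int l * \<tau>"
  then show ?thesis using latticeI[of "m+k" "n+l"] by (simp add: algebra_simps)
qed

lemma lattice_minus: "x \<in> \<Lambda> \<Longrightarrow> - x \<in> \<Lambda>"
proof (elim latticeE)
  fix m n assume "x = of_int m + of_int n * \<tau>"
  then show ?thesis using latticeI[of "-m" "-n"] by (simp add: algebra_simps)
qed

lemma lattice_minus_iff [simp]: "- x \<in> \<Lambda> \<longleftrightarrow> x \<in> \<Lambda>"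
  using lattice_minus[of x] lattice_minus[of "-x"] by auto

lemma lattice_diff: "x \<in> \<Lambda> \<Longrightarrow> y \<in> \<Lambda> \<Longrightarrow> x - y \<in> \<Lambda>"
  using lattice_add[of x "-y"] by simp

text \<open>
  A constant with |s|, |t| \<le> \<kappa> |s + t \<tau>| for all real s and t: the map to lattice coordinates is bounded.
\<close>
definition \<kappa> :: real where "\<kappa> = 1 + (1 + cmod \<tau>) / Im \<tau>"

lemma kappa_ge_1: "\<kappa> \<ge> 1"
  unfolding \<kappa>_def using Im_tau by auto

lemma coordinates_le:
  fixes s t :: real
  shows "\<bar>s\<bar> \<le> \<kappa> * cmod (of_real s + of_real t * \<tau>)"
    and "\<bar>t\<bar> \<le> \<kappa> * cmod (of_real s + of_real t * \<tau>)"
proof -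
  let ?w = "of_real s + of_real t * \<tau>"
  have "\<bar>Im ?w\<bar> \<le> cmod ?w" by (rule abs_Im_le_cmod)
  then have "\<bar>t\<bar> * Im \<tau> \<le> cmod ?w" using Im_tau by (simp add: abs_mult)
  then have t: "\<bar>t\<bar> \<le> cmod ?w / Im \<tau>" using Im_tau by (simp add: field_simps)
  also have "\<dots> \<le> \<kappa> * cmod ?w"
    unfolding \<kappa>_def using Im_tau by (simp add: field_simps)
  finally show "\<bar>t\<bar> \<le> \<kappa> * cmod ?w" .
  have "\<bar>s\<bar> = cmod (?w - of_real t * \<tau>)" by simp
  also have "\<dots> \<le> cmod ?w + \<bar>t\<bar> * cmod \<tau>"
    using norm_triangle_ineq4[of ?w "of_real t * \<tau>"] by (simp add: norm_mult)
  also have "\<dots> \<le> cmod ?w + cmod ?w / Im \<tau> * cmod \<tau>"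
    by (intro add_left_mono mult_right_mono t) auto
  also have "\<dots> \<le> \<kappa> * cmod ?w"
    unfolding \<kappa>_def using Im_tau by (simp add: field_simps)
  finally show "\<bar>s\<bar> \<le> \<kappa> * cmod ?w" .
qed

lemma int_coordinates_le:
  fixes m n :: int
  shows "\<bar>real_of_int m\<bar> \<le> \<kappa> * cmod (of_int m + of_int n * \<tau>)"
    and "\<bar>real_of_int n\<bar> \<le> \<kappa> * cmod (of_int m + of_int n * \<tau>)"
  using coordinates_le[where s = "of_int m" and t = "of_int n"] by simp_all

lemma inj_lattice_coordinates: "inj (\<lambda>(m, n). of_int m + of_int n * \<tau> :: complex)"
proof (rule injI, clarify)
  fix m n k l :: int
  assume "of_int m + of_int n * \<tau> = of_int k + of_int l * \<tau>"
  then have "of_int (m - k) + of_int (n - l) * \<tau> = 0" by (simp add: algebra_simps)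
  with int_coordinates_le[where m = "m - k" and n = "n - l"]
  have "\<bar>real_of_int (m - k)\<bar> \<le> 0" "\<bar>real_of_int (n - l)\<bar> \<le> 0" by (simp_all only: norm_zero mult_zero_right)
  then show "m = k \<and> n = l" by simp
qed

text \<open>
  Since (1 + |m|) (1 + |n|) is at most a constant times |m + n \<tau>|^2, the cube of |m + n \<tau>| dominates
  (1 + |m|)^(3/2) (1 + |n|)^(3/2), and the double sum is bounded by a product of two convergent single sums.
\<close>
lemma inverse_cube_summable: "(\<lambda>w. 1 / cmod w ^ 3) summable_on \<Lambda>"
proof -
  let ?g = "\<lambda>m::int. (1 + \<bar>real_of_int m\<bar>) powr (-3/2)"
  have *: "(\<lambda>(m,n). ?g m * ?g n) summable_on UNIV \<times> UNIV"
    using inverse_abs_powr_summable_on_int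
    by (intro summable_on_SigmaI[where g = "\<lambda>m. ?g m * infsum ?g UNIV"]
          has_sum_cmult_right has_sum_infsum summable_on_cmult_left) (auto intro: has_sum_cmult_right has_sum_infsum)
  have "(\<lambda>(m,n). 1 / cmod (of_int m + of_int n * \<tau>) ^ 3) summable_on UNIV \<times> UNIV"
  proof (rule summable_on_comparison_test)
    show "(\<lambda>(m,n). 8 * \<kappa>^3 * (?g m * ?g n)) summable_on UNIV \<times> UNIV"
      using summable_on_cmult_right[OF *, of "8 * \<kappa>^3"] by (simp add: case_prod_unfold)
    fix x :: "int \<times> int"
    obtain m n where x: "x = (m, n)" by (cases x)
    define w where "w = of_int m + of_int n * \<tau>"
    have "1 / cmod w ^ 3 \<le> 8 * \<kappa>^3 * (?g m * ?g n)"
    proof (cases "w = 0")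
      case False
      have "m \<noteq> 0 \<or> n \<noteq> 0" using False by (auto simp: w_def)
      then have "1 \<le> \<bar>real_of_int m\<bar> \<or> 1 \<le> \<bar>real_of_int n\<bar>" by linarith
      then have 1: "1 \<le> \<kappa> * cmod w"
        using int_coordinates_le[where m = m and n = n] unfolding w_def by linarith
      have mn: "1 + \<bar>real_of_int m\<bar> \<le> 2 * \<kappa> * cmod w" "1 + \<bar>real_of_int n\<bar> \<le> 2 * \<kappa> * cmod w"
        using int_coordinates_le[where m = m and n = n] 1 unfolding w_def by linarith+
      let ?y = "2 * \<kappa> * cmod w"
      have "?y powr (-3/2) \<le> ?g m" "?y powr (-3/2) \<le> ?g n"
        using mn 1 by (intro powr_mono2'; simp)+
      then have "?y powr (-3/2) * ?y powr (-3/2) \<le> ?g m * ?g n" by (intro mult_mono) auto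
      also have "?y powr (-3/2) * ?y powr (-3/2) = ?y powr (-3)"
        by (simp flip: powr_add)
      also have "\<dots> = 1 / ?y ^ 3"
      proof -
        have "0 \<le> ?y" using 1 by linarith
        then show ?thesis by (simp only: powr_minus_divide powr_numeral)
      qed
      also have "\<dots> = 1 / (8 * \<kappa>^3) * (1 / cmod w ^ 3)" by (simp add: power_mult_distrib)
      finally have "8 * \<kappa>^3 * (1 / (8 * \<kappa>^3) * (1 / cmod w ^ 3)) \<le> 8 * \<kappa>^3 * (?g m * ?g n)"
        using kappa_ge_1 by (intro mult_left_mono) auto
      then show ?thesis using kappa_ge_1 by simp
    qed (use kappa_ge_1 in auto)
    then show "(case x of (m,n) \<Rightarrow> 1 / cmod (of_int m + of_int n * \<tau>) ^ 3)
         \<le> (case x of (m,n) \<Rightarrow> 8 * \<kappa>^3 * (?g m * ?g n))"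
      by (simp add: x w_def)
  qed auto
  then show ?thesis
    unfolding lattice_eq
    by (subst summable_on_reindex[OF inj_lattice_coordinates]) (auto simp: o_def case_prod_unfold)
qed

lemma countable_lattice: "countable \<Lambda>"
  unfolding lattice_eq by auto

lemma infinite_lattice: "infinite (\<Lambda> - {0})"
proof -
  have "infinite (range (\<lambda>(m::int, n::int). of_int m + of_int n * \<tau> :: complex))"
    using finite_imageD[OF _ inj_lattice_coordinates] finite_prod[where 'a = int and 'b = int]
      infinite_UNIV_int by blast
  then show ?thesis by (simp add: lattice_eq)
qed

text \<open>
  An enumeration of the nonzero lattice points makes the library theory of Weierstrass products over
  sequences available.
\<close>
definition enum :: "nat \<Rightarrow> complex" where
  "enum = (SOME e. bij_betw e UNIV (\<Lambda> - {0}))"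

lemma bij_enum: "bij_betw enum UNIV (\<Lambda> - {0})"
proof -
  have "\<exists>e. bij_betw e (UNIV::nat set) (\<Lambda> - {0})"
    using countableE_infinite[of "\<Lambda> - {0}"] countable_lattice infinite_lattice
      bij_betw_inv by (metis countable_Diff)
  then show ?thesis unfolding enum_def by (rule someI_ex)
qed

lemma range_enum: "range enum = \<Lambda> - {0}"
  using bij_enum by (simp add: bij_betw_def)

lemma inj_enum: "inj enum"
  using bij_enum by (simp add: bij_betw_def)

lemma summable_enum: "summable (\<lambda>n. 1 / cmod (enum n) ^ 3)"
proof -
  have "(\<lambda>w. 1 / cmod w ^ 3) summable_on range enum"
    unfolding range_enum by (rule summable_on_subset_banach[OF inverse_cube_summable]) auto
  then have "(\<lambda>n. 1 / cmod (enum n) ^ 3) summable_on UNIV"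
    by (subst (asm) summable_on_reindex) (auto simp: inj_enum o_def)
  then show ?thesis by (rule summable_on_imp_summable)
qed

lemma enum_nonzero: "enum n \<noteq> 0"
  using range_enum by auto

sublocale W: weierstrass_product enum "\<lambda>_. 2"
proof
  have "(\<lambda>n. 1 / cmod (enum n) ^ 3) \<longlonglongrightarrow> 0"
    using summable_enum by (rule summable_LIMSEQ_zero)
  then have "(\<lambda>n. root 3 (1 / cmod (enum n) ^ 3)) \<longlonglongrightarrow> root 3 0"
    by (intro tendsto_intros)
  then have "(\<lambda>n. inverse (enum n)) \<longlonglongrightarrow> 0"
    by (subst tendsto_norm_zero_iff[symmetric])
       (simp add: norm_inverse real_root_inverse real_root_power_cancel divide_inverse)
  then show "filterlim enum at_infinity sequentially"
    using enum_nonzero by (intro filterlim_inverse_at_iff[THEN iffD1])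
      (auto simp: filterlim_at)
  show "summable (\<lambda>n. (r / cmod (enum n)) ^ Suc 2)" for r
    using summable_mult[OF summable_enum, of "r^3"] by (simp add: power_divide)
qed (rule enum_nonzero)

abbreviation \<sigma> :: "complex \<Rightarrow> complex" where "\<sigma> \<equiv> weierstrass_sigma 1 \<tau>"

text \<open>
  The entire function \<sigma>(z) / z.
\<close>
definition h :: "complex \<Rightarrow> complex" where "h = W.f"

text \<open>
  The unordered limit in the definition of \<sigma> is the product over the enumeration, because unordered limits
  are invariant under bijections of the index set.
\<close>
lemma prod_tendsto_h:
  "((\<lambda>W. \<Prod>w\<in>W. weierstrass_factor 2 (z / w)) \<longlongrightarrow> h z) (finite_subsets_at_top (\<Lambda> - {0}))"
proof -
  let ?g = "\<lambda>n. weierstrass_factor 2 (z / enum n)"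
  have "(prod ?g \<longlongrightarrow> h z) (finite_subsets_at_top UNIV)"
    using prod_tendsto_prodinf_finite_subsets[OF W.abs_convergent[of z]] by (simp add: h_def W.f_def)
  moreover have "prod ?g = (\<lambda>V. \<Prod>w\<in>enum ` V. weierstrass_factor 2 (z / w))"
    by (intro ext, subst prod.reindex) (auto intro: inj_on_subset[OF inj_enum])
  ultimately show ?thesis
    unfolding range_enum[symmetric] filtermap_image_finite_subsets_at_top[OF inj_enum, symmetric]
      filterlim_filtermap by simp
qed

lemma weierstrass_factor_2: "weierstrass_factor 2 x = (1 - x) * exp (x + 1 / 2 * x\<^sup>2)"
  by (simp add: weierstrass_factor_def numeral_2_eq_2)

lemma sigma_eq: "\<sigma> z = z * h z"
  unfolding weierstrass_sigma_def \<Lambda>_def[symmetric]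
  using tendsto_Lim[OF _ prod_tendsto_h[of z]] by (simp add: weierstrass_factor_2)

lemma h_holomorphic: "h holomorphic_on A"
  unfolding h_def by (rule W.holomorphic)

lemma h_eq_0_iff: "h z = 0 \<longleftrightarrow> z \<in> \<Lambda> - {0}"
  unfolding h_def W.zero range_enum ..

lemma sigma_holomorphic: "\<sigma> holomorphic_on A"
proof -
  have "\<sigma> = (\<lambda>z. z * h z)" by (auto simp: sigma_eq)
  then show ?thesis by (auto intro!: holomorphic_intros h_holomorphic)
qed

lemma sigma_eq_0_iff: "\<sigma> z = 0 \<longleftrightarrow> z \<in> \<Lambda>"
  by (auto simp: sigma_eq h_eq_0_iff)

text \<open>
  The lattice is symmetric, so replacing z by -z only permutes the factors of the unordered product.
\<close>
lemma sigma_odd: "\<sigma> (- z) = - \<sigma> z"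
proof -
  have [simp]: "uminus ` (\<Lambda> - {0}) = \<Lambda> - {0}"
    by (auto intro!: image_eqI[of _ _ "- _"])
  have "(\<Prod>w\<in>uminus ` W. weierstrass_factor 2 (z / w)) = (\<Prod>w\<in>W. weierstrass_factor 2 (- z / w))" for W
    by (subst prod.reindex) auto
  moreover have "filtermap ((`) uminus) (finite_subsets_at_top (\<Lambda> - {0})) = finite_subsets_at_top (\<Lambda> - {0})"
    by (subst filtermap_image_finite_subsets_at_top) auto
  then have "((\<lambda>W. \<Prod>w\<in>uminus ` W. weierstrass_factor 2 (z / w)) \<longlongrightarrow> h z) (finite_subsets_at_top (\<Lambda> - {0}))"
    using prod_tendsto_h[of z] by (metis filterlim_filtermap)
  ultimately have
    "((\<lambda>W. \<Prod>w\<in>W. weierstrass_factor 2 (- z / w)) \<longlongrightarrow> h z) (finite_subsets_at_top (\<Lambda> - {0}))"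
    by simp
  from tendsto_unique[OF _ this prod_tendsto_h[of "-z"]] show ?thesis
    by (simp add: sigma_eq)
qed

section \<open>Quasi-periodicity\<close>

lemma lattice_ball_finite: "finite {w \<in> \<Lambda>. cmod w \<le> r}"
proof -
  let ?I = "{m::int. \<bar>real_of_int m\<bar> \<le> \<kappa> * r}"
  have "finite ?I"
  proof (rule finite_subset)
    show "?I \<subseteq> {- \<lceil>\<kappa> * r\<rceil> .. \<lceil>\<kappa> * r\<rceil>}"
      by (auto simp: abs_le_iff) linarith+
  qed auto
  moreover have "{w \<in> \<Lambda>. cmod w \<le> r} \<subseteq> (\<lambda>(m,n). of_int m + of_int n * \<tau>) ` (?I \<times> ?I)"
  proof
    fix w assume w: "w \<in> {w \<in> \<Lambda>. cmod w \<le> r}"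
    then obtain m n where mn: "w = of_int m + of_int n * \<tau>" by (auto elim: latticeE)
    have "\<kappa> * cmod w \<le> \<kappa> * r" using w kappa_ge_1 by auto
    then have "\<bar>real_of_int m\<bar> \<le> \<kappa> * r" "\<bar>real_of_int n\<bar> \<le> \<kappa> * r"
      using int_coordinates_le[where m = m and n = n] unfolding mn by linarith+
    then show "w \<in> (\<lambda>(m,n). of_int m + of_int n * \<tau>) ` (?I \<times> ?I)"
      by (auto simp: mn)
  qed
  ultimately show ?thesis by (meson finite_SigmaI finite_imageI finite_subset)
qed

lemma summable_on_lattice_comparison:
  fixes g :: "complex \<Rightarrow> complex"
  assumes "\<And>w. w \<in> \<Lambda> \<Longrightarrow> cmod w > r \<Longrightarrow> cmod (g w) \<le> C / cmod w ^ 3"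
  shows "g summable_on \<Lambda>"
proof -
  let ?F = "{w \<in> \<Lambda>. cmod w \<le> r}"
  have "(\<lambda>w. C * (1 / cmod w ^ 3)) summable_on (\<Lambda> - ?F)"
    by (intro summable_on_cmult_right summable_on_subset_banach[OF inverse_cube_summable]) auto
  then have "(\<lambda>w. norm (g w)) summable_on (\<Lambda> - ?F)"
    by (rule summable_on_comparison_test) (use assms in auto)
  then have "g summable_on (\<Lambda> - ?F)" by (rule abs_summable_summable)
  moreover have "g summable_on ?F" by (rule summable_on_finite[OF lattice_ball_finite])
  ultimately have "g summable_on ((\<Lambda> - ?F) \<union> ?F)" by (intro summable_on_union)
  then show ?thesis by (simp add: Un_absorb2)
qed

text \<open>
  The finite partial products of \<sigma>, indexed by finite sets V that may contain 0. Allowing 0 makes the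
  index sets stable under translation by a lattice vector.
\<close>
definition sigma_part :: "complex set \<Rightarrow> complex \<Rightarrow> complex" where
  "sigma_part V z = z * (\<Prod>w\<in>V - {0}. weierstrass_factor 2 (z / w))"

lemma sigma_part_tendsto:
  "((\<lambda>V. sigma_part V z) \<longlongrightarrow> \<sigma> z) (finite_subsets_at_top \<Lambda>)"
proof -
  have "filterlim (\<lambda>V. V - {0}) (finite_subsets_at_top (\<Lambda> - {0})) (finite_subsets_at_top \<Lambda>)"
    unfolding filterlim_iff
  proof (intro allI impI)
    fix P assume "eventually P (finite_subsets_at_top (\<Lambda> - {0}))"
    then obtain X where X: "finite X" "X \<subseteq> \<Lambda> - {0}"
        "\<forall>Y. finite Y \<and> X \<subseteq> Y \<and> Y \<subseteq> \<Lambda> - {0} \<longrightarrow> P Y"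
      unfolding eventually_finite_subsets_at_top by blast
    have "P (V - {0})" if "finite V" "X \<subseteq> V" "V \<subseteq> \<Lambda>" for V
    proof -
      have "finite (V - {0})" "X \<subseteq> V - {0}" "V - {0} \<subseteq> \<Lambda> - {0}" using that X(2) by auto
      then show ?thesis using X(3) by simp
    qed
    then show "eventually (\<lambda>V. P (V - {0})) (finite_subsets_at_top \<Lambda>)"
      unfolding eventually_finite_subsets_at_top
      using X(1,2) by (intro exI[of _ X] conjI allI impI) blast+
  qed
  from filterlim_compose[OF prod_tendsto_h this, of z]
  show ?thesis unfolding sigma_part_def sigma_eq by (intro tendsto_mult tendsto_const)
qed

lemma sigma_part_eq:
  assumes "finite V" "0 \<in> V"
  shows "sigma_part V z = (\<Prod>w\<in>V - {0}. - 1 / w) * (\<Prod>w\<in>V. z - w) *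
           exp (z * (\<Sum>w\<in>V. 1 / w) + z\<^sup>2 / 2 * (\<Sum>w\<in>V. 1 / w\<^sup>2))"
proof -
  have "(\<Prod>w\<in>V - {0}. weierstrass_factor 2 (z / w)) =
        (\<Prod>w\<in>V - {0}. (- 1 / w) * (z - w) * exp (z * (1 / w) + z\<^sup>2 / 2 * (1 / w\<^sup>2)))"
    by (intro prod.cong) (auto simp: weierstrass_factor_2 field_simps power2_eq_square)
  also have "\<dots> = (\<Prod>w\<in>V - {0}. - 1 / w) * (\<Prod>w\<in>V - {0}. z - w) *
      exp (\<Sum>w\<in>V - {0}. z * (1 / w) + z\<^sup>2 / 2 * (1 / w\<^sup>2))"
    by (simp only: prod.distrib exp_sum[OF finite_Diff[OF assms(1)]])
  also have "(\<Sum>w\<in>V - {0}. z * (1 / w) + z\<^sup>2 / 2 * (1 / w\<^sup>2)) =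
      (\<Sum>w\<in>V. z * (1 / w) + z\<^sup>2 / 2 * (1 / w\<^sup>2))"
    using assms by (subst (2) sum.remove[of _ 0]) auto
  also have "\<dots> = z * (\<Sum>w\<in>V. 1 / w) + z\<^sup>2 / 2 * (\<Sum>w\<in>V. 1 / w\<^sup>2)"
    by (simp only: sum.distrib sum_distrib_left)
  finally show ?thesis
    unfolding sigma_part_def using assms by (subst (2) prod.remove[of _ 0]) (auto simp: mult_ac)
qed

text \<open>
  The change in the coefficient of z in the exponent of a partial product when its index set is
  translated by \<omega>, written as a sum over the index set. Grouped in this way the sum converges absolutely.
  At w = 0 and w = \<omega> some quotients have the default value 0, which is what the formula for
  the partial products needs.
\<close>
definition quasi_period_term :: "complex \<Rightarrow> complex \<Rightarrow> complex" where
  "quasi_period_term \<omega> w = 1 / w + \<omega> / w\<^sup>2 - 1 / (w - \<omega>)"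

text \<open>
  The number usually written \<eta>(\<omega>), the increment of the Weierstrass zeta function over the period \<omega>.
\<close>
definition quasi_period :: "complex \<Rightarrow> complex" where
  "quasi_period \<omega> = infsum (quasi_period_term \<omega>) \<Lambda>"

lemma far_from_period:
  assumes "cmod w > 2 * cmod \<omega>"
  shows "w \<noteq> 0" "w \<noteq> \<omega>" "cmod (w - \<omega>) \<ge> cmod w / 2"
  using assms norm_triangle_ineq2[of w \<omega>] by auto

lemma quasi_period_term_summable: "quasi_period_term \<omega> summable_on \<Lambda>"
proof (rule summable_on_lattice_comparison)
  fix w assume w: "cmod w > 2 * cmod \<omega>"
  note far = far_from_period[OF w]
  have "quasi_period_term \<omega> w = - (\<omega>\<^sup>2) / (w\<^sup>2 * (w - \<omega>))"
    using far unfolding quasi_period_term_def by (simp add: divide_simps) algebra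
  then have "cmod (quasi_period_term \<omega> w) = cmod \<omega> ^ 2 / (cmod w ^ 2 * cmod (w - \<omega>))"
    by (simp add: norm_divide norm_mult norm_power)
  also have "\<dots> \<le> cmod \<omega> ^ 2 / (cmod w ^ 2 * (cmod w / 2))"
    using far by (intro divide_left_mono mult_left_mono mult_pos_pos) auto
  also have "\<dots> = 2 * cmod \<omega> ^ 2 / cmod w ^ 3"
    by (simp add: power3_eq_cube power2_eq_square)
  finally show "cmod (quasi_period_term \<omega> w) \<le> 2 * cmod \<omega> ^ 2 / cmod w ^ 3" .
qed

lemma square_difference_summable: "(\<lambda>w. 1 / w\<^sup>2 - 1 / (w - \<omega>)\<^sup>2) summable_on \<Lambda>"
proof (rule summable_on_lattice_comparison)
  fix w assume w: "cmod w > 2 * cmod \<omega>"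
  note far = far_from_period[OF w]
  have "1 / w\<^sup>2 - 1 / (w - \<omega>)\<^sup>2 = \<omega> * (\<omega> - 2 * w) / (w\<^sup>2 * (w - \<omega>)\<^sup>2)"
    using far by (simp add: divide_simps) algebra
  then have "cmod (1 / w\<^sup>2 - 1 / (w - \<omega>)\<^sup>2) =
      cmod \<omega> * cmod (\<omega> - 2 * w) / (cmod w ^ 2 * cmod (w - \<omega>) ^ 2)"
    by (simp add: norm_divide norm_mult norm_power)
  also have "\<dots> \<le> cmod \<omega> * (3 * cmod w) / (cmod w ^ 2 * (cmod w / 2) ^ 2)"
  proof (intro frac_le mult_left_mono power_mono mult_pos_pos)
    show "cmod (\<omega> - 2 * w) \<le> 3 * cmod w"
    proof -
      have "cmod (\<omega> - 2 * w) \<le> cmod \<omega> + 2 * cmod w"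
        using norm_triangle_ineq4[of \<omega> "2 * w"] by (simp add: norm_mult)
      then show ?thesis using w norm_ge_zero[of \<omega>] by linarith
    qed
  qed (use far in auto)
  also have "\<dots> = 12 * cmod \<omega> / cmod w ^ 3"
    using far by (simp add: power3_eq_cube power2_eq_square field_simps)
  finally show "cmod (1 / w\<^sup>2 - 1 / (w - \<omega>)\<^sup>2) \<le> 12 * cmod \<omega> / cmod w ^ 3" .
qed

text \<open>
  The reflection w \<mapsto> \<omega> - w permutes the lattice and changes the sign of the summand.
\<close>
lemma infsum_square_difference:
  assumes "\<omega> \<in> \<Lambda>"
  shows "infsum (\<lambda>w. 1 / w\<^sup>2 - 1 / (w - \<omega>)\<^sup>2) \<Lambda> = 0"
proof -
  let ?g = "\<lambda>w. 1 / w\<^sup>2 - 1 / (w - \<omega>)\<^sup>2"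
  have "bij_betw (\<lambda>w. \<omega> - w) \<Lambda> \<Lambda>"
    using assms by (intro bij_betwI[where g = "\<lambda>w. \<omega> - w"]) (auto intro: lattice_diff)
  then have "infsum ?g \<Lambda> = infsum (\<lambda>w. ?g (\<omega> - w)) \<Lambda>"
    by (intro infsum_reindex_bij_betw[symmetric])
  also have "(\<lambda>w. ?g (\<omega> - w)) = (\<lambda>w. - ?g w)"
    by (auto simp: power2_commute)
  also have "infsum (\<lambda>w. - ?g w) \<Lambda> = - infsum ?g \<Lambda>" by (rule infsum_uminus)
  finally show ?thesis by simp
qed

text \<open>
  A partial product over V is a constant times \<Prod>(z - w) exp(z S1 + z^2 S2 / 2), where S1 and S2 are the
  sums of 1/w and 1/w^2 over V. Shifting z by \<omega> amounts to translating V, so the quotient of the two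
  partial products is the exponential of a quadratic polynomial in z. Its coefficients of z and of z^2 converge
  along the finite subsets of the lattice, the latter to 0. Comparing two points z and y removes the constant
  factor.
\<close>
lemma sigma_ratio:
  assumes \<omega>: "\<omega> \<in> \<Lambda>" and z: "z \<notin> \<Lambda>" and y: "y \<notin> \<Lambda>"
  shows "\<sigma> (z + \<omega>) / \<sigma> z = exp (quasi_period \<omega> * (z - y)) * (\<sigma> (y + \<omega>) / \<sigma> y)"
proof -
  let ?F = "finite_subsets_at_top \<Lambda>"
  define sh where "sh V = (\<lambda>w. w - \<omega>) ` V" for V :: "complex set"
  have surj: "(\<lambda>w. w - \<omega>) ` \<Lambda> = \<Lambda>"
    using \<omega> by (auto intro: lattice_diff intro!: image_eqI[of _ _ "_ + \<omega>"] lattice_add)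
  \<comment> \<open>Translation permutes the finite subsets of the lattice, so the translated partial products
    converge along the same filter.\<close>
  have "filtermap sh ?F = ?F"
    unfolding sh_def using filtermap_image_finite_subsets_at_top[of "\<lambda>w. w - \<omega>" \<Lambda>] surj
    by (auto simp: inj_on_def)
  then have sh_lim: "((\<lambda>V. sigma_part (sh V) x) \<longlongrightarrow> \<sigma> x) ?F" for x
    using sigma_part_tendsto[of x] filterlim_filtermap[of "\<lambda>V. sigma_part V x" _ sh ?F] by simp
  define q where "q V x = sigma_part V (x + \<omega>) / sigma_part (sh V) x" for V x
  have q_lim: "((\<lambda>V. q V x) \<longlongrightarrow> \<sigma> (x + \<omega>) / \<sigma> x) ?F" if "x \<notin> \<Lambda>" for x
    unfolding q_def using that
    by (intro tendsto_divide sigma_part_tendsto sh_lim) (simp add: sigma_eq_0_iff)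
  define A where "A V = (\<Sum>w\<in>V. quasi_period_term \<omega> w)" for V
  define B where "B V = (\<Sum>w\<in>V. 1 / w\<^sup>2 - 1 / (w - \<omega>)\<^sup>2)" for V :: "complex set"
  have lims: "(A \<longlongrightarrow> quasi_period \<omega>) ?F" "(B \<longlongrightarrow> 0) ?F"
    unfolding A_def quasi_period_def B_def infsum_square_difference[OF \<omega>, symmetric]
    by (intro infsum_tendsto quasi_period_term_summable square_difference_summable)+
  have q_eq: "q V z = exp (A V * (z - y) + B V / 2 * (z\<^sup>2 - y\<^sup>2)) * q V y"
    if V: "finite V" "{0, \<omega>} \<subseteq> V" "V \<subseteq> \<Lambda>" for V
  proof -
    have inj: "inj_on (\<lambda>w. w - \<omega>) V" by (auto simp: inj_on_def)
    have sh: "finite (sh V)" "0 \<in> sh V" using V by (auto simp: sh_def image_iff intro!: bexI[of _ \<omega>])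
    define k where "k = (\<Prod>w\<in>V - {0}. - 1 / w) / (\<Prod>w\<in>sh V - {0}. - 1 / w)"
    define c where "c = \<omega> * (\<Sum>w\<in>V. 1 / w) + \<omega>\<^sup>2 / 2 * (\<Sum>w\<in>V. 1 / w\<^sup>2)"
    have AV: "A V = (\<Sum>w\<in>V. 1 / w) + \<omega> * (\<Sum>w\<in>V. 1 / w\<^sup>2) - (\<Sum>w\<in>V. 1 / (w - \<omega>))"
      unfolding A_def quasi_period_term_def by (simp add: sum.distrib sum_subtractf sum_distrib_left)
    have BV: "B V = (\<Sum>w\<in>V. 1 / w\<^sup>2) - (\<Sum>w\<in>V. 1 / (w - \<omega>)\<^sup>2)"
      unfolding B_def by (rule sum_subtractf)
    have "q V x = k * exp (c + A V * x + B V / 2 * x\<^sup>2)" if x: "x \<notin> \<Lambda>" for x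
    proof -
      have sh_prod: "(\<Prod>w\<in>sh V. x - w) = (\<Prod>w\<in>V. x + \<omega> - w)"
        unfolding sh_def by (subst prod.reindex[OF inj]) (auto intro!: prod.cong)
      have nz: "(\<Prod>w\<in>V. x + \<omega> - w) \<noteq> 0"
        using V x \<omega> lattice_diff[of _ \<omega>] by (auto simp: eq_diff_eq[symmetric])
      have s1: "(\<Sum>w\<in>sh V. 1 / w) = (\<Sum>w\<in>V. 1 / (w - \<omega>))"
        and s2: "(\<Sum>w\<in>sh V. 1 / w\<^sup>2) = (\<Sum>w\<in>V. 1 / (w - \<omega>)\<^sup>2)"
        unfolding sh_def by (subst sum.reindex[OF inj]; simp)+
      have "q V x = k * (exp ((x + \<omega>) * (\<Sum>w\<in>V. 1 / w) + (x + \<omega>)\<^sup>2 / 2 * (\<Sum>w\<in>V. 1 / w\<^sup>2)) /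
           exp (x * (\<Sum>w\<in>V. 1 / (w - \<omega>)) + x\<^sup>2 / 2 * (\<Sum>w\<in>V. 1 / (w - \<omega>)\<^sup>2)))"
        unfolding q_def sigma_part_eq[OF V(1) , of "x + \<omega>", OF subsetD[OF V(2)], OF insertI1]
          sigma_part_eq[OF sh] sh_prod s1 s2 k_def using nz by simp
      also have "\<dots> = k * exp (((x + \<omega>) * (\<Sum>w\<in>V. 1 / w) + (x + \<omega>)\<^sup>2 / 2 * (\<Sum>w\<in>V. 1 / w\<^sup>2)) -
           (x * (\<Sum>w\<in>V. 1 / (w - \<omega>)) + x\<^sup>2 / 2 * (\<Sum>w\<in>V. 1 / (w - \<omega>)\<^sup>2)))"
        by (simp only: exp_diff)
      also have "((x + \<omega>) * (\<Sum>w\<in>V. 1 / w) + (x + \<omega>)\<^sup>2 / 2 * (\<Sum>w\<in>V. 1 / w\<^sup>2)) -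
           (x * (\<Sum>w\<in>V. 1 / (w - \<omega>)) + x\<^sup>2 / 2 * (\<Sum>w\<in>V. 1 / (w - \<omega>)\<^sup>2))
           = c + A V * x + B V / 2 * x\<^sup>2"
        unfolding c_def AV BV by (simp add: algebra_simps power2_eq_square add_divide_distrib diff_divide_distrib)
      finally show ?thesis .
    qed
    from this[OF z] this[OF y] show ?thesis
      by (simp add: exp_add[symmetric] algebra_simps)
  qed
  have "eventually (\<lambda>V. exp (A V * (z - y) + B V / 2 * (z\<^sup>2 - y\<^sup>2)) * q V y = q V z) ?F"
    unfolding eventually_finite_subsets_at_top
    using q_eq \<omega> by (intro exI[of _ "{0, \<omega>}"]) auto
  moreover have "((\<lambda>V. exp (A V * (z - y) + B V / 2 * (z\<^sup>2 - y\<^sup>2)) * q V y) \<longlongrightarrow>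
       exp (quasi_period \<omega> * (z - y) + 0 / 2 * (z\<^sup>2 - y\<^sup>2)) * (\<sigma> (y + \<omega>) / \<sigma> y)) ?F"
    by (intro tendsto_intros lims q_lim y) auto
  ultimately have "((\<lambda>V. q V z) \<longlongrightarrow>
       exp (quasi_period \<omega> * (z - y) + 0 / 2 * (z\<^sup>2 - y\<^sup>2)) * (\<sigma> (y + \<omega>) / \<sigma> y)) ?F"
    by (rule Lim_transform_eventually[rotated])
  from tendsto_unique[OF _ q_lim[OF z] this] show ?thesis by simp
qed

text \<open>
  The constant factor is found at z = -\<omega>/2, where oddness of \<sigma> makes the quotient equal to -1. This needs that
  \<omega>/2 is not itself a lattice point.
\<close>
lemma sigma_quasi_periodic:
  assumes "\<omega> \<in> \<Lambda>" "\<omega> / 2 \<notin> \<Lambda>"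
  shows "\<sigma> (z + \<omega>) = - exp (quasi_period \<omega> * (z + \<omega> / 2)) * \<sigma> z"
proof (cases "z \<in> \<Lambda>")
  case True
  then show ?thesis using assms lattice_add[of z \<omega>] by (metis mult_zero_right sigma_eq_0_iff)
next
  case False
  have "\<sigma> (- (\<omega> / 2) + \<omega>) / \<sigma> (- (\<omega> / 2)) = -1"
    using assms(2) sigma_eq_0_iff[of "\<omega> / 2"] by (simp add: sigma_odd)
  moreover have "\<sigma> (z + \<omega>) / \<sigma> z = exp (quasi_period \<omega> * (z - - (\<omega> / 2))) *
      (\<sigma> (- (\<omega> / 2) + \<omega>) / \<sigma> (- (\<omega> / 2)))"
    using assms(2) by (intro sigma_ratio[OF assms(1) False]) (simp del: minus_divide_left)
  ultimately have "\<sigma> (z + \<omega>) / \<sigma> z = - exp (quasi_period \<omega> * (z + \<omega> / 2))"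
    by simp
  then show ?thesis using False sigma_eq_0_iff[of z] by (simp add: field_simps)
qed

section \<open>The quadratic form that governs the growth\<close>

lemma in_lattice_iff_coordinates:
  "of_real s + of_real t * \<tau> \<in> \<Lambda> \<longleftrightarrow> s \<in> \<int> \<and> t \<in> \<int>"
proof
  assume "of_real s + of_real t * \<tau> \<in> \<Lambda>"
  then obtain m n where "of_real s + of_real t * \<tau> = of_int m + of_int n * \<tau>" by (rule latticeE)
  then have "of_real (s - of_int m) + of_real (t - of_int n) * \<tau> = 0" by (simp add: algebra_simps)
  with coordinates_le[where s = "s - of_int m" and t = "t - of_int n"]
  have "\<bar>s - of_int m\<bar> \<le> 0" "\<bar>t - of_int n\<bar> \<le> 0" by (simp_all only: norm_zero mult_zero_right)
  then show "s \<in> \<int> \<and> t \<in> \<int>" by simp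
next
  assume "s \<in> \<int> \<and> t \<in> \<int>"
  then show "of_real s + of_real t * \<tau> \<in> \<Lambda>" by (auto elim!: Ints_cases)
qed

lemma half_not_int: "(1 / 2 :: real) \<notin> \<int>"
proof
  assume "(1 / 2 :: real) \<in> \<int>"
  then obtain n :: int where "(1/2 :: real) = of_int n" by (rule Ints_cases)
  then have "real_of_int (2 * n) = 1" by simp
  then have "2 * n = 1" by linarith
  then show False by presburger
qed

lemma half_periods_not_in_lattice: "1 / 2 \<notin> \<Lambda>" "\<tau> / 2 \<notin> \<Lambda>"
  using in_lattice_iff_coordinates[of "1/2" 0] in_lattice_iff_coordinates[of 0 "1/2"] half_not_int
  by simp_all

lemmas sigma_add_1 = sigma_quasi_periodic[OF one_in_lattice half_periods_not_in_lattice(1)]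
  and sigma_add_tau = sigma_quasi_periodic[OF tau_in_lattice half_periods_not_in_lattice(2)]

text \<open>
  Legendre's relation up to the value of N: shifting by 1 and \<tau> in either order gives the same value, so
  two exponentials agree.
\<close>
lemma legendre_weak: "\<exists>N::int. quasi_period 1 * \<tau> - quasi_period \<tau> = 2 * of_real pi * of_int N * \<i>"
proof -
  let ?z = "1/2 :: complex" and ?A = "quasi_period 1" and ?B = "quasi_period \<tau>"
  have "\<sigma> (?z + 1 + \<tau>) = exp (?A * (?z + \<tau> + 1/2)) * exp (?B * (?z + \<tau>/2)) * \<sigma> ?z"
    using sigma_add_1[of "?z + \<tau>"] sigma_add_tau[of ?z] by (simp add: add_ac)
  moreover have "\<sigma> (?z + 1 + \<tau>) = exp (?B * (?z + 1 + \<tau>/2)) * exp (?A * (?z + 1/2)) * \<sigma> ?z"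
    using sigma_add_tau[of "?z + 1"] sigma_add_1[of ?z] by simp
  moreover have "\<sigma> ?z \<noteq> 0" using half_periods_not_in_lattice sigma_eq_0_iff by simp
  ultimately have "exp (?A * (?z + \<tau> + 1/2) + ?B * (?z + \<tau>/2)) = exp (?B * (?z + 1 + \<tau>/2) + ?A * (?z + 1/2))"
    by (simp add: exp_add)
  then obtain n :: int where
    "?A * (?z + \<tau> + 1/2) + ?B * (?z + \<tau>/2) = ?B * (?z + 1 + \<tau>/2) + ?A * (?z + 1/2) + (of_int (2*n) * pi) * \<i>"
    using exp_eq by blast
  then have "8 * (?A * \<tau> - ?B) = 8 * (2 * of_real pi * of_int n * \<i>)" by (simp add: field_simps)
  then have "?A * \<tau> - ?B = 2 * of_real pi * of_int n * \<i>" by (metis mult_cancel_left zero_neq_numeral)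
  then show ?thesis by blast
qed

text \<open>
  By the preceding lemma this is \<pi> N / Im \<tau>.
\<close>
definition a :: real where
  "a = Im (quasi_period 1 * \<tau> - quasi_period \<tau>) / (2 * Im \<tau>)"

definition \<gamma> :: complex where "\<gamma> = quasi_period 1 - of_real a"

text \<open>
  The real-linear map that takes the values of the quasi-periods at 1 and \<tau>, hence at all lattice
  points. Up to complex conjugation it is also the gradient of the quadratic form Q.
\<close>
definition lin :: "complex \<Rightarrow> complex" where "lin z = \<gamma> * z + of_real a * cnj z"

definition Q :: "complex \<Rightarrow> real" where "Q z = (a * (cmod z)\<^sup>2 + Re (\<gamma> * z\<^sup>2)) / 2"

lemma a_eq: "\<exists>N::int. a = pi * of_int N / Im \<tau>"
proof -
  obtain N :: int where N: "quasi_period 1 * \<tau> - quasi_period \<tau> = 2 * of_real pi * of_int N * \<i>"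
    using legendre_weak by blast
  show ?thesis unfolding a_def N using Im_tau by (intro exI[of _ N]) simp
qed

lemma quasi_period_eq_lin: "quasi_period 1 = lin 1" "quasi_period \<tau> = lin \<tau>"
proof -
  show "quasi_period 1 = lin 1" by (simp add: lin_def \<gamma>_def)
  obtain N :: int where N: "quasi_period 1 * \<tau> - quasi_period \<tau> = 2 * of_real pi * of_int N * \<i>"
    using legendre_weak by blast
  have "2 * of_real (a * Im \<tau>) * \<i> = quasi_period 1 * \<tau> - quasi_period \<tau>"
    unfolding N a_def using Im_tau by (simp add: complex_eq_iff)
  moreover have "of_real a * (\<tau> - cnj \<tau>) = 2 * of_real (a * Im \<tau>) * \<i>"
    by (simp add: complex_eq_iff)
  ultimately show "quasi_period \<tau> = lin \<tau>"
    unfolding lin_def \<gamma>_def by (simp add: algebra_simps)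
qed

lemma lin_add: "lin (z + w) = lin z + lin w"
  by (simp add: lin_def algebra_simps)

text \<open>
  For w \<in> {1, \<tau>} the increment of Q is the logarithm of the factor by which |\<sigma>| changes, so |\<sigma>| exp(-Q) is
  periodic.
\<close>
lemma Q_add: "Q (z + w) = Q z + Re (lin w * (z + w / 2))"
  unfolding Q_def lin_def cmod_power2
  by (simp add: power2_eq_square) (simp add: algebra_simps add_divide_distrib diff_divide_distrib)

text \<open>
  What remains of the derivative of \<sigma> after removing its main term lin(z) \<sigma>(z). It satisfies the same
  functional equation as \<sigma>, so |R| exp(-Q) is periodic as well; unlike the logarithmic derivative it has
  no poles.
\<close>
definition R :: "complex \<Rightarrow> complex" where "R z = deriv \<sigma> z - lin z * \<sigma> z"

lemma sigma_field_derivative: "(\<sigma> has_field_derivative deriv \<sigma> z) (at z)"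
  using sigma_holomorphic[of UNIV] by (simp add: holomorphic_derivI)

lemma sigma_deriv_quasi_periodic:
  assumes "\<omega> \<in> \<Lambda>" "\<omega> / 2 \<notin> \<Lambda>"
  shows "deriv \<sigma> (z + \<omega>) = - exp (quasi_period \<omega> * (z + \<omega> / 2)) * (quasi_period \<omega> * \<sigma> z + deriv \<sigma> z)"
proof -
  have "((\<lambda>z. \<sigma> (z + \<omega>)) has_field_derivative deriv \<sigma> (z + \<omega>)) (at z)"
    using sigma_field_derivative[of "z + \<omega>"] by (subst DERIV_shift[symmetric])
  moreover have "(\<lambda>z. \<sigma> (z + \<omega>)) = (\<lambda>z. - exp (quasi_period \<omega> * (z + \<omega> / 2)) * \<sigma> z)"
    using sigma_quasi_periodic[OF assms] by auto
  moreover have "((\<lambda>z. - exp (quasi_period \<omega> * (z + \<omega> / 2)) * \<sigma> z) has_field_derivative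
       - exp (quasi_period \<omega> * (z + \<omega> / 2)) * (quasi_period \<omega> * \<sigma> z + deriv \<sigma> z)) (at z)"
    by (auto intro!: derivative_eq_intros sigma_field_derivative simp: algebra_simps)
  ultimately show ?thesis using DERIV_unique by metis
qed

lemma deriv_sigma_even: "deriv \<sigma> (- z) = deriv \<sigma> z"
proof -
  have "((\<lambda>z. - \<sigma> (- z)) has_field_derivative deriv \<sigma> (- z)) (at z)"
    using DERIV_minus[OF DERIV_chain'[OF DERIV_minus[OF DERIV_ident] sigma_field_derivative], of z] by simp
  then have "(\<sigma> has_field_derivative deriv \<sigma> (- z)) (at z)" by (simp add: sigma_odd)
  then show ?thesis using sigma_field_derivative DERIV_unique by blast
qed

text \<open>
  Differentiating the functional equation at z = -1/2 and using that \<sigma> is odd and its derivative even.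
\<close>
lemma quasi_period_1_eq_zeta: "quasi_period 1 = 2 * weierstrass_zeta 1 \<tau> (1 / 2)"
proof -
  have "deriv \<sigma> (1 / 2) = - (quasi_period 1 * \<sigma> (- (1 / 2)) + deriv \<sigma> (- (1 / 2)))"
    using sigma_deriv_quasi_periodic[OF one_in_lattice half_periods_not_in_lattice(1), of "- (1 / 2)"]
    by simp
  then have "2 * deriv \<sigma> (1 / 2) = quasi_period 1 * \<sigma> (1 / 2)"
    using sigma_odd[of "1 / 2"] deriv_sigma_even[of "1 / 2"] by simp
  moreover have "\<sigma> (1 / 2) \<noteq> 0" using half_periods_not_in_lattice sigma_eq_0_iff by simp
  ultimately show ?thesis unfolding weierstrass_zeta_def by (simp add: field_simps)
qed

lemma periodic_lattice:
  fixes g :: "complex \<Rightarrow> real"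
  assumes 1: "\<And>z. g (z + 1) = g z" and \<tau>: "\<And>z. g (z + \<tau>) = g z" and "w \<in> \<Lambda>"
  shows "g (z + w) = g z"
proof -
  have *: "g (z + of_int m * p) = g z" if p: "\<And>z. g (z + p) = g z" for m :: int and p z
  proof (induction m rule: int_induct[where k = 0])
    case (step1 i)
    then show ?case using p[of "z + of_int i * p"] by (simp add: algebra_simps)
  next
    case (step2 i)
    then show ?case using p[of "z + of_int (i - 1) * p"] by (simp add: algebra_simps)
  qed simp
  obtain m n where "w = of_int m + of_int n * \<tau>" using \<open>w \<in> \<Lambda>\<close> by (rule latticeE)
  then show ?thesis
    using *[OF 1, where m = m and z = "z + of_int n * \<tau>"] *[OF \<tau>, where m = n and z = z]
    by (simp add: add_ac)
qed

lemma exp_Q_add: "\<omega> \<in> {1, \<tau>} \<Longrightarrow>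
    cmod (exp (quasi_period \<omega> * (z + \<omega> / 2))) * exp (- Q (z + \<omega>)) = exp (- Q z)"
  using quasi_period_eq_lin Q_add[of z \<omega>] by (auto simp flip: exp_add)

lemma sigma_periodic_modulus:
  assumes "w \<in> \<Lambda>"
  shows "cmod (\<sigma> (z + w)) * exp (- Q (z + w)) = cmod (\<sigma> z) * exp (- Q z)"
proof (rule periodic_lattice[where g = "\<lambda>z. cmod (\<sigma> z) * exp (- Q z)", OF _ _ assms])
  show "cmod (\<sigma> (z + 1)) * exp (- Q (z + 1)) = cmod (\<sigma> z) * exp (- Q z)" for z
    using exp_Q_add[of 1 z] unfolding sigma_add_1 by (simp add: norm_mult mult_ac)
  show "cmod (\<sigma> (z + \<tau>)) * exp (- Q (z + \<tau>)) = cmod (\<sigma> z) * exp (- Q z)" for z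
    using exp_Q_add[of \<tau> z] unfolding sigma_add_tau by (simp add: norm_mult mult_ac)
qed

lemma R_periodic_modulus:
  assumes "w \<in> \<Lambda>"
  shows "cmod (R (z + w)) * exp (- Q (z + w)) = cmod (R z) * exp (- Q z)"
proof -
  have *: "cmod (R (z + \<omega>)) * exp (- Q (z + \<omega>)) = cmod (R z) * exp (- Q z)"
    if "\<omega> \<in> {1, \<tau>}" for z \<omega>
  proof -
    have \<omega>: "\<omega> \<in> \<Lambda>" "\<omega> / 2 \<notin> \<Lambda>" using that half_periods_not_in_lattice by auto
    have "R (z + \<omega>) = - exp (quasi_period \<omega> * (z + \<omega> / 2)) * R z"
      unfolding R_def sigma_deriv_quasi_periodic[OF \<omega>] sigma_quasi_periodic[OF \<omega>] lin_add
      using that quasi_period_eq_lin by (auto simp: algebra_simps)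
    then show ?thesis using exp_Q_add[OF that, of z] by (simp add: norm_mult mult_ac)
  qed
  show ?thesis
    using *[of 1] *[of \<tau>] by (intro periodic_lattice[where g = "\<lambda>z. cmod (R z) * exp (- Q z)", OF _ _ assms]) auto
qed

text \<open>
  A closed fundamental parallelogram centred at 0. The centring matters: 0 is its only lattice point.
\<close>
definition cell :: "complex set" where
  "cell = (\<lambda>(s, t). of_real s + of_real t * \<tau>) ` ({-1/2..1/2} \<times> {-1/2..1/2})"

lemma compact_cell: "compact cell"
  unfolding cell_def
  by (intro compact_continuous_image compact_Times) (auto intro!: continuous_intros simp: case_prod_unfold)

lemma cell_cover:
  obtains w where "w \<in> \<Lambda>" "z - w \<in> cell"
proof -
  define t where "t = Im z / Im \<tau>"
  define s where "s = Re z - t * Re \<tau>"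
  have z: "z = of_real s + of_real t * \<tau>"
    using Im_tau by (simp add: complex_eq_iff s_def t_def)
  have *: "\<bar>x - of_int (round x)\<bar> \<le> 1/2" for x :: real
    using of_int_round_abs_le[of x] by (simp only: abs_minus_commute)
  have "z - (of_int (round s) + of_int (round t) * \<tau>) =
      of_real (s - of_int (round s)) + of_real (t - of_int (round t)) * \<tau>"
    by (simp add: z algebra_simps)
  moreover have "\<dots> \<in> cell"
    unfolding cell_def
  proof (rule image_eqI)
    show "(s - of_int (round s), t - of_int (round t)) \<in> {-1/2..1/2} \<times> {-1/2..1/2}"
      using *[of s] *[of t] by (simp only: mem_Times_iff fst_conv snd_conv atLeastAtMost_iff) linarith
  qed (simp only: prod.case)
  ultimately show ?thesis using that latticeI by metis
qed

lemma cell_lattice: "z \<in> cell \<Longrightarrow> z \<in> \<Lambda> \<Longrightarrow> z = 0"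
proof -
  assume "z \<in> cell" "z \<in> \<Lambda>"
  then obtain s t where st: "z = of_real s + of_real t * \<tau>" "\<bar>s\<bar> \<le> 1/2" "\<bar>t\<bar> \<le> 1/2" "s \<in> \<int>" "t \<in> \<int>"
    unfolding cell_def using in_lattice_iff_coordinates by (fastforce simp: abs_le_iff)
  then have "s = 0" "t = 0" using Ints_nonzero_abs_less1[of s] Ints_nonzero_abs_less1[of t] by auto
  then show ?thesis using st by simp
qed

lemma continuous_Q: "continuous_on A Q"
  unfolding Q_def by (intro continuous_intros) auto

lemma continuous_R: "continuous_on A R"
proof -
  have "continuous_on UNIV (deriv \<sigma>)" "continuous_on UNIV \<sigma>"
    using holomorphic_deriv[OF sigma_holomorphic open_UNIV] sigma_holomorphic[of UNIV]
    by (auto intro: holomorphic_on_imp_continuous_on)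
  then have "continuous_on UNIV R"
    unfolding R_def lin_def by (intro continuous_intros)
  then show ?thesis by (rule continuous_on_subset) auto
qed

lemma compact_bounded_above:
  fixes g :: "complex \<Rightarrow> real"
  assumes "continuous_on UNIV g"
  shows "\<exists>C. \<forall>z\<in>cell. g z \<le> C"
proof -
  have "compact (g ` cell)"
    by (intro compact_continuous_image compact_cell continuous_on_subset[OF assms]) auto
  then have "bdd_above (g ` cell)" by (simp add: bounded_imp_bdd_above compact_imp_bounded)
  then show ?thesis by (auto simp: bdd_above_def)
qed

text \<open>
  The first two bounds are those of periodic continuous functions. For the third, h has no zeros in the
  compact cell; a point z is moved into the cell by some lattice vector w, and there |\<sigma>(z - w)| = |z - w| |h(z - w)|.
\<close>
lemma growth_bounds:
  obtains c C where "c > 0" "C > 0"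
    "\<And>z. cmod (\<sigma> z) \<le> C * exp (Q z)"
    "\<And>z. cmod (R z) \<le> C * exp (Q z)"
    "\<And>z. \<exists>w\<in>\<Lambda>. cmod (\<sigma> z) \<ge> c * exp (Q z) * cmod (z - w)"
proof -
  have \<sigma>: "continuous_on UNIV \<sigma>" by (rule holomorphic_on_imp_continuous_on[OF sigma_holomorphic])
  obtain C1 where C1: "\<And>z. z \<in> cell \<Longrightarrow> cmod (\<sigma> z) * exp (- Q z) \<le> C1"
    using compact_bounded_above[of "\<lambda>z. cmod (\<sigma> z) * exp (- Q z)",
        OF continuous_on_mult[OF continuous_on_norm[OF \<sigma>] continuous_on_exp[OF continuous_on_minus[OF continuous_Q]]]]
    by blast
  obtain C2 where C2: "\<And>z. z \<in> cell \<Longrightarrow> cmod (R z) * exp (- Q z) \<le> C2"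
    using compact_bounded_above[of "\<lambda>z. cmod (R z) * exp (- Q z)",
        OF continuous_on_mult[OF continuous_on_norm[OF continuous_R] continuous_on_exp[OF continuous_on_minus[OF continuous_Q]]]]
    by blast
  have nz: "h z \<noteq> 0" if "z \<in> cell" for z using cell_lattice[OF that] h_eq_0_iff[of z] by auto
  have "cell \<noteq> {}" by (auto simp: cell_def)
  moreover have "continuous_on cell (\<lambda>z. cmod (h z) * exp (- Q z))"
    by (intro continuous_intros continuous_Q holomorphic_on_imp_continuous_on h_holomorphic)
  ultimately obtain z0 where z0: "z0 \<in> cell"
      "\<And>z. z \<in> cell \<Longrightarrow> cmod (h z0) * exp (- Q z0) \<le> cmod (h z) * exp (- Q z)"
    using continuous_attains_inf[OF compact_cell] by blast
  define c where "c = cmod (h z0) * exp (- Q z0)"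
  define C where "C = \<bar>C1\<bar> + \<bar>C2\<bar> + 1"
  show ?thesis
  proof
    show "c > 0" using nz[OF z0(1)] by (simp add: c_def)
    show "C > 0" by (simp add: C_def)
    fix z
    obtain w where w: "w \<in> \<Lambda>" "z - w \<in> cell" by (rule cell_cover)
    have "cmod (\<sigma> z) * exp (- Q z) \<le> C"
      using sigma_periodic_modulus[OF w(1), of "z - w"] C1[OF w(2)] by (simp add: C_def)
    then show "cmod (\<sigma> z) \<le> C * exp (Q z)" by (simp add: exp_minus field_simps)
    have "cmod (R z) * exp (- Q z) \<le> C"
      using R_periodic_modulus[OF w(1), of "z - w"] C2[OF w(2)] by (simp add: C_def)
    then show "cmod (R z) \<le> C * exp (Q z)" by (simp add: exp_minus field_simps)
    have "c * cmod (z - w) \<le> cmod (h (z - w)) * exp (- Q (z - w)) * cmod (z - w)"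
      unfolding c_def by (intro mult_right_mono z0 w) auto
    also have "\<dots> = cmod (\<sigma> z) * exp (- Q z)"
      using sigma_periodic_modulus[OF w(1), of "z - w"] by (simp add: sigma_eq norm_mult mult_ac)
    finally have "cmod (\<sigma> z) \<ge> c * exp (Q z) * cmod (z - w)"
      by (simp add: exp_minus field_simps)
    then show "\<exists>w\<in>\<Lambda>. cmod (\<sigma> z) \<ge> c * exp (Q z) * cmod (z - w)" using w by blast
  qed
qed

text \<open>
  The integer N in a = \<pi> N / Im \<tau> is positive. Otherwise \<sigma>(z) exp(-\<gamma> z^2 / 2), whose modulus is at most
  C exp(a |z|^2 / 2), would be bounded and hence constant, with value 0 at 0.
\<close>
lemma a_ge: "a \<ge> pi / Im \<tau>"
proof -
  obtain N :: int where N: "a = pi * of_int N / Im \<tau>" using a_eq by blast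
  have "\<not> a \<le> 0"
  proof
    assume a: "a \<le> 0"
    obtain c C where C: "C > 0" "\<And>z. cmod (\<sigma> z) \<le> C * exp (Q z)" using growth_bounds by metis
    define g where "g z = \<sigma> z * exp (- (\<gamma> * z\<^sup>2 / 2))" for z
    have "g holomorphic_on UNIV" unfolding g_def by (intro holomorphic_intros sigma_holomorphic) auto
    moreover have "bounded (range g)"
    proof (rule boundedI)
      fix y assume "y \<in> range g"
      then obtain z where "y = g z" by auto
      then have "cmod y = cmod (\<sigma> z) * exp (- Re (\<gamma> * z\<^sup>2) / 2)"
        by (simp add: g_def norm_mult del: times_complex.sel)
      also have "\<dots> \<le> C * exp (Q z) * exp (- Re (\<gamma> * z\<^sup>2) / 2)"
        using C by (intro mult_right_mono) auto
      also have "\<dots> = C * exp (a * (cmod z)\<^sup>2 / 2)"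
        by (simp add: Q_def mult.assoc exp_add[symmetric] add_divide_distrib del: times_complex.sel)
      also have "\<dots> \<le> C * exp 0"
        using C(1) a by (intro mult_left_mono) (auto simp: mult_le_0_iff)
      finally show "cmod y \<le> C" by simp
    qed
    ultimately obtain k where k: "\<And>z. g z = k" using Liouville_theorem[of g] by (auto simp: constant_on_def)
    have "g 0 = 0" by (simp add: g_def sigma_eq)
    then have "g (1/2) = 0" using k[of 0] k[of "1/2"] by simp
    then have "\<sigma> (1/2) = 0" by (simp add: g_def)
    then show False using half_periods_not_in_lattice sigma_eq_0_iff by simp
  qed
  then have "of_int N > (0::real)" using N Im_tau by (simp add: zero_less_divide_iff zero_less_mult_iff not_le)
  then have "of_int N \<ge> (1::real)" by simp
  then show ?thesis unfolding N using Im_tau by (simp add: divide_right_mono)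
qed

lemma a_pos: "a > 0" using a_ge Im_tau by (smt (verit) divide_pos_pos pi_gt_zero)

end

locale positive_lattice = lattice +
  assumes positivity: "Re (1 / (2 * weierstrass_zeta 1 \<tau> (1 / 2))) \<ge> Im \<tau> / (2 * pi)"
begin

text \<open>
  The inequality Re(1 / \<eta>) \<ge> 1 / (2 a) is equivalent to |\<eta> - a| \<le> a, for \<eta> \<noteq> 0. The hypothesis gives it
  because 1 / (2 a) \<le> Im \<tau> / (2 \<pi>).
\<close>
lemma cmod_gamma_le: "cmod \<gamma> \<le> a"
proof -
  let ?\<eta> = "quasi_period 1"
  have 1: "Re (1 / ?\<eta>) \<ge> Im \<tau> / (2 * pi)" using positivity by (simp add: quasi_period_1_eq_zeta)
  have "?\<eta> \<noteq> 0"
  proof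
    assume "?\<eta> = 0"
    then have "Im \<tau> / (2 * pi) \<le> 0" using 1 by simp
    then show False using Im_tau pi_gt_zero by (simp add: divide_le_0_iff)
  qed
  have "1 / (2 * a) \<le> Im \<tau> / (2 * pi)"
    using a_ge a_pos Im_tau by (simp add: field_simps)
  also have "\<dots> \<le> Re ?\<eta> / (cmod ?\<eta>)\<^sup>2"
    using 1 by (simp add: Re_divide cmod_power2)
  finally have "(cmod ?\<eta>)\<^sup>2 \<le> 2 * a * Re ?\<eta>"
    using \<open>?\<eta> \<noteq> 0\<close> a_pos by (simp add: field_simps)
  then have "(cmod \<gamma>)\<^sup>2 \<le> a\<^sup>2"
    unfolding \<gamma>_def cmod_power2 by (simp add: power2_eq_square algebra_simps)
  then show ?thesis using a_pos by (simp add: power2_le_iff_abs_le)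
qed

text \<open>
  The rotation that diagonalises Q: a square root of the direction of \<gamma>.
\<close>
definition v :: complex where "v = cis (Arg \<gamma> / 2)"

lemma cmod_v [simp]: "cmod v = 1"
  by (simp add: v_def)

lemma gamma_eq: "\<gamma> = of_real (cmod \<gamma>) * v\<^sup>2"
  using rcis_cmod_Arg[of \<gamma>] by (simp add: v_def rcis_def Complex.DeMoivre)

lemma cmod_power2_v: "(cmod z)\<^sup>2 = (Re (v * z))\<^sup>2 + (Im (v * z))\<^sup>2"
  using cmod_power2[of "v * z"] by (simp add: norm_mult)

lemma Re_of_real_mult: "Re (of_real r * z) = r * Re z" and Re_power2: "Re (z\<^sup>2) = (Re z)\<^sup>2 - (Im z)\<^sup>2"
  by (simp_all add: power2_eq_square)

lemma Q_eq: "Q z = ((a + cmod \<gamma>) * (Re (v * z))\<^sup>2 + (a - cmod \<gamma>) * (Im (v * z))\<^sup>2) / 2"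
proof -
  have "\<gamma> * z\<^sup>2 = of_real (cmod \<gamma>) * (v * z)\<^sup>2" 
    by (subst gamma_eq) (simp add: power_mult_distrib)
  then have "Re (\<gamma> * z\<^sup>2) = cmod \<gamma> * ((Re (v * z))\<^sup>2 - (Im (v * z))\<^sup>2)"
    by (simp only: Re_of_real_mult Re_power2)
  moreover have "a * (x + y) + g * (x - y) = (a + g) * x + (a - g) * y" for x y g :: real
    by (simp add: algebra_simps)
  ultimately show ?thesis unfolding Q_def cmod_power2_v by (simp only:)
qed

text \<open>
  In the coordinates given by v the form is diagonal with eigenvalues (a + |\<gamma>|) / 2 and (a - |\<gamma>|) / 2,
  the second of which may vanish.
\<close>
lemma Q_lower: "Q z \<ge> a / 2 * (Re (v * z))\<^sup>2"
proof -
  have "(a - cmod \<gamma>) * (Im (v * z))\<^sup>2 \<ge> 0" "cmod \<gamma> * (Re (v * z))\<^sup>2 \<ge> 0"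
    using cmod_gamma_le by auto
  then have "a * (Re (v * z))\<^sup>2 \<le> (a + cmod \<gamma>) * (Re (v * z))\<^sup>2 + (a - cmod \<gamma>) * (Im (v * z))\<^sup>2"
    unfolding distrib_right by linarith
  then show ?thesis unfolding Q_eq by simp
qed

lemma lin_lower: "cmod (lin z) \<ge> a * \<bar>Re (v * z)\<bar>"
proof -
  have vv: "v * cnj v = 1" by (simp add: complex_norm_square[symmetric])
  have "cnj v * lin z = of_real (cmod \<gamma>) * (v * z) * (v * cnj v) + of_real a * cnj (v * z)"
    unfolding lin_def by (subst gamma_eq) (simp add: algebra_simps power2_eq_square)
  also have "\<dots> = of_real (cmod \<gamma>) * (v * z) + of_real a * cnj (v * z)" by (simp only: vv mult_1_right)
  finally have "Re (cnj v * lin z) = (cmod \<gamma> + a) * Re (v * z)"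
    by (simp add: algebra_simps)
  moreover have "\<bar>Re (cnj v * lin z)\<bar> \<le> cmod (cnj v * lin z)" by (rule abs_Re_le_cmod)
  moreover have "cmod (cnj v * lin z) = cmod (lin z)" by (simp add: norm_mult)
  ultimately have "(cmod \<gamma> + a) * \<bar>Re (v * z)\<bar> \<le> cmod (lin z)"
    using a_pos by (simp add: abs_mult)
  moreover have "cmod \<gamma> * \<bar>Re (v * z)\<bar> \<ge> 0" by simp
  ultimately show ?thesis by (simp only: distrib_right)
qed

lemma cmod_lin_le: "cmod (lin z) \<le> 2 * a * cmod z"
proof -
  have "cmod (lin z) \<le> cmod \<gamma> * cmod z + a * cmod z"
    unfolding lin_def using norm_triangle_ineq[of "\<gamma> * z" "of_real a * cnj z"] a_pos by (simp add: norm_mult)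
  also have "\<dots> \<le> a * cmod z + a * cmod z" by (intro add_right_mono mult_right_mono cmod_gamma_le) auto
  finally show ?thesis by (simp add: mult_ac)
qed

lemma Q_upper: "Q z \<le> a * (cmod z)\<^sup>2"
proof -
  have "Re (\<gamma> * z\<^sup>2) \<le> cmod \<gamma> * (cmod z)\<^sup>2"
    using complex_Re_le_cmod[of "\<gamma> * z\<^sup>2"] by (simp add: norm_mult norm_power)
  also have "\<dots> \<le> a * (cmod z)\<^sup>2" by (intro mult_right_mono cmod_gamma_le) auto
  finally show ?thesis by (simp add: Q_def)
qed

lemma Q_shift: "Q (z + w) \<le> Q z + a * cmod w * (2 * cmod z + cmod w)"
proof -
  have "Re (lin w * (z + w / 2)) \<le> cmod (lin w) * cmod (z + w / 2)"
    using complex_Re_le_cmod[of "lin w * (z + w / 2)"] by (simp add: norm_mult)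
  also have "\<dots> \<le> (2 * a * cmod w) * (cmod z + cmod w / 2)"
    using norm_triangle_ineq[of z "w/2"] a_pos by (intro mult_mono cmod_lin_le) (auto simp: norm_divide)
  finally show ?thesis unfolding Q_add by (simp add: algebra_simps)
qed

end

section \<open>Area and expanding maps\<close>

text \<open>
  The inverse of f is Lipschitz with constant 1/c. Cover E efficiently by dyadic squares with disjoint
  interiors; the part of X that f maps into a square of side t has diameter at most 2 t / c and so lies in
  a disc of area 4 \<pi> t^2 / c^2.
\<close>
lemma emeasure_expanding_le:
  fixes f :: "complex \<Rightarrow> complex"
  assumes E: "E \<in> sets borel" "bounded E" and fX: "f ` X \<subseteq> E" and c: "c > 0"
    and expand: "\<And>x y. x \<in> X \<Longrightarrow> y \<in> X \<Longrightarrow> c * dist x y \<le> dist (f x) (f y)"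
  shows "emeasure lborel X \<le> ennreal (4 * pi / c\<^sup>2) * emeasure lborel E"
proof -
  obtain s where s: "s > 0" "E \<subseteq> cbox (Complex (- s) (- s)) (Complex s s)"
  proof -
    obtain b where b: "b > 0" "\<And>x. x \<in> E \<Longrightarrow> cmod x \<le> b" using E(2) bounded_pos by metis
    have "E \<subseteq> cbox (Complex (- b) (- b)) (Complex b b)"
    proof
      fix x assume "x \<in> E"
      then show "x \<in> cbox (Complex (- b) (- b)) (Complex b b)"
        using b(2)[of x] abs_Re_le_cmod[of x] abs_Im_le_cmod[of x] by (auto simp: in_cbox_complex_iff)
    qed
    with b that show thesis by blast
  qed
  let ?a = "Complex (- s) (- s)" and ?b = "Complex s s"
  have box: "box ?a ?b \<noteq> {}" using s(1) by (auto simp: box_ne_empty Basis_complex_def)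
  have E_leb: "E \<in> lmeasurable" using E by (intro bounded_set_imp_lmeasurable) auto
  have main: "emeasure lborel X \<le> ennreal (4 * pi / c\<^sup>2) * (emeasure lborel E + ennreal e)" if e: "e > 0" for e
  proof -
    obtain \<D> where \<D>: "countable \<D>"
       "\<And>K. K \<in> \<D> \<Longrightarrow> K \<subseteq> cbox ?a ?b \<and> K \<noteq> {} \<and> (\<exists>c d. K = cbox c d)"
       "pairwise (\<lambda>A B. interior A \<inter> interior B = {}) \<D>"
       "\<And>u v. cbox u v \<in> \<D> \<Longrightarrow> \<exists>n. \<forall>i \<in> Basis. v \<bullet> i - u \<bullet> i = (?b \<bullet> i - ?a \<bullet> i)/2^n"
       "E \<subseteq> \<Union>\<D>" "\<Union>\<D> \<in> lmeasurable" "measure lebesgue (\<Union>\<D>) \<le> measure lebesgue E + e"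
      by (rule measurable_outer_intervals_bounded[OF E_leb s(2) e]) (rule that, assumption+)
    have "\<exists>Y. Y \<in> sets lborel \<and> X \<inter> f -` K \<subseteq> Y \<and> emeasure lborel Y \<le> ennreal (4 * pi / c\<^sup>2) * emeasure lborel (interior K)"
      if K: "K \<in> \<D>" for K
    proof -
      obtain u w where uw: "K = cbox u w" using \<D>(2)[OF K] by blast
      obtain n where n: "\<forall>i \<in> Basis. w \<bullet> i - u \<bullet> i = (?b \<bullet> i - ?a \<bullet> i)/2^n"
        using \<D>(4)[of u w] K uw by blast
      define t where "t = 2 * s / 2 ^ n"
      have t: "t > 0" "Re w - Re u = t" "Im w - Im u = t"
        using n s(1) by (auto simp: t_def Basis_complex_def)
      have int: "emeasure lborel (interior K) = ennreal (t\<^sup>2)"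
        unfolding uw interior_cbox using t
        by (subst emeasure_lborel_box) (auto simp: Basis_complex_def power2_eq_square)
      show ?thesis
      proof (cases "X \<inter> f -` K = {}")
        case False
        then obtain x where x: "x \<in> X" "f x \<in> K" by auto
        have "dist x y \<le> 2 * t / c" if "y \<in> X" "f y \<in> K" for y
        proof -
          have "c * dist x y \<le> dist (f x) (f y)" using expand x(1) that(1) by blast
          also have "\<dots> \<le> \<bar>Re (f x - f y)\<bar> + \<bar>Im (f x - f y)\<bar>"
            unfolding dist_norm by (rule cmod_le)
          also have "\<dots> \<le> t + t"
            using x(2) that(2) t(2,3) unfolding uw by (intro add_mono) (auto simp: in_cbox_complex_iff)
          finally show ?thesis using c by (simp add: field_simps)
        qed
        then have "X \<inter> f -` K \<subseteq> cball x (2 * t / c)" by auto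
        moreover have "emeasure lborel (cball x (2 * t / c)) = ennreal (4 * pi / c\<^sup>2) * ennreal (t\<^sup>2)"
          using t(1) c by (subst emeasure_cball) (auto simp: unit_ball_vol_2 power_divide power_mult_distrib ennreal_mult[symmetric])
        ultimately show ?thesis unfolding int by (intro exI[of _ "cball x (2 * t / c)"]) auto
      qed auto
    qed
    then have "\<forall>K\<in>\<D>. \<exists>Y. Y \<in> sets lborel \<and> X \<inter> f -` K \<subseteq> Y \<and>
        emeasure lborel Y \<le> ennreal (4 * pi / c\<^sup>2) * emeasure lborel (interior K)" by (rule ballI)
    from bchoice[OF this] obtain Y where "\<forall>K\<in>\<D>. Y K \<in> sets lborel \<and> X \<inter> f -` K \<subseteq> Y K \<and>
        emeasure lborel (Y K) \<le> ennreal (4 * pi / c\<^sup>2) * emeasure lborel (interior K)"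
      by (rule exE)
    then have Y: "\<And>K. K \<in> \<D> \<Longrightarrow> Y K \<in> sets lborel" "\<And>K. K \<in> \<D> \<Longrightarrow> X \<inter> f -` K \<subseteq> Y K"
      "\<And>K. K \<in> \<D> \<Longrightarrow> emeasure lborel (Y K) \<le> ennreal (4 * pi / c\<^sup>2) * emeasure lborel (interior K)"
      by blast+
    define I where "I = to_nat_on \<D> ` \<D>"
    have I: "from_nat_into \<D> n \<in> \<D>" if "n \<in> I" for n
      using that \<D>(1) by (auto simp: I_def)
    have I_inj: "from_nat_into \<D> n \<noteq> from_nat_into \<D> m" if "n \<in> I" "m \<in> I" "n \<noteq> m" for n m
      using that \<D>(1) by (auto simp: I_def)
    define Y' where "Y' n = (if n \<in> I then Y (from_nat_into \<D> n) else {})" for n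
    define K' where "K' n = (if n \<in> I then interior (from_nat_into \<D> n) else {})" for n
    have "X \<subseteq> (\<Union>n. Y' n)"
    proof
      fix x assume "x \<in> X"
      then obtain K where K: "K \<in> \<D>" "f x \<in> K" using fX \<D>(5) by blast
      then have "x \<in> Y' (to_nat_on \<D> K)" using Y(2)[OF K(1)] \<open>x \<in> X\<close> \<D>(1) by (auto simp: Y'_def I_def)
      then show "x \<in> (\<Union>n. Y' n)" by blast
    qed
    moreover have Y'_sets: "range Y' \<subseteq> sets lborel" using Y(1) I by (auto simp: Y'_def)
    ultimately have "emeasure lborel X \<le> emeasure lborel (\<Union>n. Y' n)"
      by (intro emeasure_mono) auto
    also have "\<dots> \<le> (\<Sum>n. emeasure lborel (Y' n))"
      using Y'_sets by (intro emeasure_subadditive_countably) auto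
    also have "\<dots> \<le> (\<Sum>n. ennreal (4 * pi / c\<^sup>2) * emeasure lborel (K' n))"
      by (intro suminf_le) (auto simp: Y'_def K'_def intro!: Y(3) I)
    also have "\<dots> = ennreal (4 * pi / c\<^sup>2) * (\<Sum>n. emeasure lborel (K' n))"
      by (rule ennreal_suminf_cmult)
    also have "(\<Sum>n. emeasure lborel (K' n)) = emeasure lborel (\<Union>n. K' n)"
    proof (rule suminf_emeasure)
      have "K' n \<inter> K' m = {}" if "n \<noteq> m" for n m
      proof (cases "n \<in> I \<and> m \<in> I")
        case True
        then have "interior (from_nat_into \<D> n) \<inter> interior (from_nat_into \<D> m) = {}"
          using pairwiseD[OF \<D>(3) I[of n] I[of m] I_inj] that by blast
        then show ?thesis using True by (simp add: K'_def)
      qed (auto simp: K'_def)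
      then show "disjoint_family K'" by (simp add: disjoint_family_on_def)
    qed (auto simp: K'_def)
    finally have X: "emeasure lborel X \<le> ennreal (4 * pi / c\<^sup>2) * emeasure lborel (\<Union>n. K' n)" .
    have "emeasure lborel (\<Union>n. K' n) \<le> emeasure lebesgue (\<Union>\<D>)"
    proof -
      have "(\<Union>n. K' n) \<in> sets borel" by (auto simp: K'_def)
      then have "emeasure lborel (\<Union>n. K' n) = emeasure lebesgue (\<Union>n. K' n)" by simp
      also have "\<dots> \<le> emeasure lebesgue (\<Union>\<D>)"
      proof (rule emeasure_mono)
        have "K' n \<subseteq> \<Union>\<D>" for n
          using I[of n] interior_subset[of "from_nat_into \<D> n"] unfolding K'_def by auto
        then show "(\<Union>n. K' n) \<subseteq> \<Union>\<D>" by blast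
      qed (use \<D>(6) in blast)
      finally show ?thesis .
    qed
    also have "\<dots> = ennreal (measure lebesgue (\<Union>\<D>))"
      using \<D>(6) by (simp add: emeasure_eq_measure2)
    also have "\<dots> \<le> ennreal (measure lebesgue E + e)" by (intro ennreal_leI \<D>)
    also have "\<dots> = ennreal (measure lebesgue E) + ennreal e" using e by simp
    also have "ennreal (measure lebesgue E) = emeasure lborel E"
      unfolding emeasure_eq_measure2[OF E_leb, symmetric] using E(1) by simp
    finally show ?thesis by (intro order_trans[OF X] mult_left_mono) auto
  qed
  have "emeasure lborel X \<le> ennreal (4 * pi / c\<^sup>2) * emeasure lborel E + ennreal e'" if "e' > 0" for e'
  proof -
    have "e' / (4 * pi / c\<^sup>2) > 0" using c that by simp
    from main[OF this] have "emeasure lborel X \<le> ennreal (4 * pi / c\<^sup>2) * emeasure lborel E +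
        ennreal (4 * pi / c\<^sup>2) * ennreal (e' / (4 * pi / c\<^sup>2))"
      by (simp only: distrib_left)
    also have "ennreal (4 * pi / c\<^sup>2) * ennreal (e' / (4 * pi / c\<^sup>2)) = ennreal e'"
      using c that by (subst ennreal_mult[symmetric]) (simp_all del: ennreal_mult)
    finally show ?thesis .
  qed
  then show ?thesis by (rule ennreal_le_epsilon)
qed

section \<open>Good points\<close>

lemma second_derivative_bound:
  assumes hol: "f holomorphic_on UNIV" and "s > 0"
    and M: "\<And>x. cmod (x - u) \<le> s \<Longrightarrow> cmod (f x) \<le> M"
  shows "cmod (deriv (deriv f) u) \<le> 2 * M / s\<^sup>2"
proof -
  have "norm ((deriv ^^ 2) f u) \<le> fact 2 * M / s ^ 2"
    using assms by (intro Cauchy_inequality) 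
      (auto intro: holomorphic_on_subset holomorphic_on_imp_continuous_on simp: norm_minus_commute)
  then show ?thesis by (simp add: numeral_2_eq_2)
qed

lemma almost_linear_imp_expanding:
  assumes hol: "f holomorphic_on UNIV"
    and close: "\<And>u. u \<in> ball y \<rho> \<Longrightarrow> cmod (deriv f u - d) \<le> cmod d / 2"
    and x: "x1 \<in> ball y \<rho>" "x2 \<in> ball y \<rho>"
  shows "cmod d / 2 * dist x1 x2 \<le> dist (f x1) (f x2)"
proof -
  have der: "(f has_field_derivative deriv f u) (at u)" for u
    using hol by (simp add: holomorphic_derivI)
  have "cmod ((f x1 - d * x1) - (f x2 - d * x2)) \<le> cmod d / 2 * cmod (x1 - x2)"
  proof (rule field_differentiable_bound[OF convex_ball _ _ x(1) x(2)])
    show "((\<lambda>u. f u - d * u) has_field_derivative deriv f u - d) (at u within ball y \<rho>)" for u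
      by (auto intro!: derivative_eq_intros has_field_derivative_at_within[OF der])
  qed (rule close)
  moreover have "cmod (d * (x1 - x2)) \<le> cmod (f x1 - f x2) + cmod ((f x1 - d * x1) - (f x2 - d * x2))"
    using norm_triangle_ineq4[of "f x1 - f x2" "(f x1 - d * x1) - (f x2 - d * x2)"]
    by (simp add: algebra_simps)
  ultimately show ?thesis by (simp add: dist_norm norm_mult)
qed

context positive_lattice begin

text \<open>
  The exponents are chosen so that the two kinds of bad points have area of the same order in a dyadic
  annulus. The second condition says that the distance from z to w is less than |z|^(-1/4).
\<close>
definition bad :: "complex \<Rightarrow> bool" where
  "bad z \<longleftrightarrow> (Re (v * z))\<^sup>2 < cmod z \<or> (\<exists>w\<in>\<Lambda>. cmod (z - w) ^ 4 * cmod z < 1)"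

text \<open>
  At a good point y of modulus r one has Q(y) \<ge> a r / 2, and the lattice point w in the lower bound for
  |\<sigma>(y)| costs only a factor r^(-1/4). The main term of \<sigma>'(y) / \<sigma>(y) is lin(y), of size at least a r^(1/2),
  while the remainder R(y) / \<sigma>(y) is O(r^(1/4)). On the disc of radius 1/r about y the form Q varies by
  O(1), so Cauchy's estimate bounds the second derivative of \<sigma> by O(r^(9/4)) |\<sigma>(y)| on the concentric disc
  of half that radius, and on the disc of radius r^(-3) the derivative is nearly constant.
\<close>
lemma good_point_estimates:
  obtains R0 where "R0 \<ge> 1"
    "\<And>y. cmod y \<ge> R0 \<Longrightarrow> \<not> bad y \<Longrightarrow> exp (a / 4 * cmod y) \<le> cmod (\<sigma> y)"
    "\<And>y. cmod y \<ge> R0 \<Longrightarrow> \<not> bad y \<Longrightarrow> 2 * cmod y \<le> cmod (\<sigma> y)"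
    "\<And>y. cmod y \<ge> R0 \<Longrightarrow> \<not> bad y \<Longrightarrow> cmod (\<sigma> y) \<le> cmod (deriv \<sigma> y)"
    "\<And>y x1 x2. cmod y \<ge> R0 \<Longrightarrow> \<not> bad y \<Longrightarrow> x1 \<in> ball y (1 / cmod y ^ 3) \<Longrightarrow> x2 \<in> ball y (1 / cmod y ^ 3) \<Longrightarrow>
       cmod (\<sigma> y) / 2 * dist x1 x2 \<le> dist (\<sigma> x1) (\<sigma> x2)"
proof -
  obtain c C where c: "c > 0" and C: "C > 0"
    and up: "\<And>z. cmod (\<sigma> z) \<le> C * exp (Q z)" and R_up: "\<And>z. cmod (R z) \<le> C * exp (Q z)"
    and low: "\<And>z. \<exists>w\<in>\<Lambda>. cmod (\<sigma> z) \<ge> c * exp (Q z) * cmod (z - w)"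
    using growth_bounds by metis
  note ap = a_pos
  \<comment> \<open>These four inequalities hold for large r; they give, in this order, the exponential lower bound,
    its comparison with 2r, the bound for the derivative, and the smallness of its variation.\<close>
  have "eventually (\<lambda>r::real. c * exp (a / 2 * r) * r powr (-1/4) \<ge> exp (a / 4 * r)) at_top"
    using c ap by real_asymp
  moreover have "eventually (\<lambda>r::real. exp (a / 4 * r) \<ge> 2 * r) at_top"
    using ap by real_asymp
  moreover have "eventually (\<lambda>r::real. a * sqrt r - C / c * r powr (1/4) \<ge> 1) at_top"
    using ap by real_asymp
  moreover have "eventually (\<lambda>r::real. 8 * C * exp (3 * a) / c * r powr (1/4) / r \<le> 1 / 2) at_top"
    by real_asymp
  ultimately have "eventually (\<lambda>r::real. c * exp (a / 2 * r) * r powr (-1/4) \<ge> exp (a / 4 * r) \<and>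
      exp (a / 4 * r) \<ge> 2 * r \<and> a * sqrt r - C / c * r powr (1/4) \<ge> 1 \<and>
      8 * C * exp (3 * a) / c * r powr (1/4) / r \<le> 1 / 2) at_top"
    by eventually_elim auto
  then obtain R1 where R1: "\<And>r. r \<ge> R1 \<Longrightarrow> c * exp (a / 2 * r) * r powr (-1/4) \<ge> exp (a / 4 * r) \<and>
      exp (a / 4 * r) \<ge> 2 * r \<and> a * sqrt r - C / c * r powr (1/4) \<ge> 1 \<and>
      8 * C * exp (3 * a) / c * r powr (1/4) / r \<le> 1 / 2"
    unfolding eventually_at_top_linorder by blast
  define R0 where "R0 = max 2 R1"
  show ?thesis
  proof (rule that[of R0])
    show "R0 \<ge> 1" by (simp add: R0_def)
    fix y assume y: "cmod y \<ge> R0" and good: "\<not> bad y"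
    define r where "r = cmod y"
    have r2: "r \<ge> 2" and r1: "r \<ge> 1" and r: "r \<ge> R1" using y by (auto simp: R0_def r_def)
    note est = R1[OF r]
    define q where "q = exp (Q y)"
    have q: "q > 0" by (simp add: q_def)
    have Re: "(Re (v * y))\<^sup>2 \<ge> r" using good by (auto simp: bad_def r_def not_less)
    obtain w where w: "w \<in> \<Lambda>" "cmod (\<sigma> y) \<ge> c * q * cmod (y - w)"
      using low[of y] unfolding q_def by blast
    have "1 \<le> cmod (y - w) ^ 4 * r" using good w(1) by (auto simp: bad_def r_def not_less)
    then have "1 / r \<le> cmod (y - w) ^ 4" using r1 by (simp add: field_simps)
    also have "1 / r = (r powr (-1/4)) ^ 4"
      using r1 powr_power[where z = r and n = 4 and u = "-1/4"] powr_minus_divide[of r 1] by simp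
    finally have dist: "r powr (-1/4) \<le> cmod (y - w)"
      by (subst (asm) power_mono_iff) auto
    have s1: "c * q * r powr (-1/4) \<le> cmod (\<sigma> y)"
    proof -
      have "c * q * r powr (-1/4) \<le> c * q * cmod (y - w)" using c q by (intro mult_left_mono dist) auto
      with w(2) show ?thesis by linarith
    qed
    have "Q y \<ge> a / 2 * r"
    proof -
      have "a / 2 * r \<le> a / 2 * (Re (v * y))\<^sup>2" using ap by (intro mult_left_mono Re) auto
      then show ?thesis using Q_lower[of y] by linarith
    qed
    then have "c * exp (a / 2 * r) * r powr (-1/4) \<le> c * q * r powr (-1/4)"
      using c unfolding q_def by (intro mult_right_mono mult_left_mono) auto
    with s1 est have sig: "exp (a / 4 * r) \<le> cmod (\<sigma> y)" by linarith
    show "exp (a / 4 * cmod y) \<le> cmod (\<sigma> y)" using sig by (simp add: r_def)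
    show "2 * cmod y \<le> cmod (\<sigma> y)" using sig est by (simp add: r_def)
    have q_le: "q \<le> cmod (\<sigma> y) * r powr (1/4) / c"
    proof -
      have "c * q = c * q * r powr (-1/4) * r powr (1/4)"
        using r1 by (simp add: mult.assoc flip: powr_add)
      also have "\<dots> \<le> cmod (\<sigma> y) * r powr (1/4)" by (intro mult_right_mono s1) auto
      finally show ?thesis using c by (simp add: field_simps)
    qed
    have "sqrt r \<le> \<bar>Re (v * y)\<bar>" using real_sqrt_le_mono[OF Re] by simp
    then have "a * sqrt r \<le> cmod (lin y)"
    proof -
      have "a * sqrt r \<le> a * \<bar>Re (v * y)\<bar>"
        using ap \<open>sqrt r \<le> \<bar>Re (v * y)\<bar>\<close> by (intro mult_left_mono) auto
      then show ?thesis using lin_lower[of y] by linarith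
    qed
    then have "a * sqrt r * cmod (\<sigma> y) \<le> cmod (lin y * \<sigma> y)"
      by (simp add: norm_mult mult_right_mono)
    moreover have "cmod (R y) \<le> C / c * r powr (1/4) * cmod (\<sigma> y)"
    proof -
      have "cmod (R y) \<le> C * q" using R_up[of y] by (simp add: q_def)
      also have "\<dots> \<le> C * (cmod (\<sigma> y) * r powr (1/4) / c)" using C by (intro mult_left_mono q_le) auto
      finally show ?thesis by (simp add: mult_ac)
    qed
    moreover have "cmod (lin y * \<sigma> y) \<le> cmod (deriv \<sigma> y) + cmod (R y)"
      using norm_triangle_ineq4[of "deriv \<sigma> y" "R y"] by (simp add: R_def)
    ultimately have "(a * sqrt r - C / c * r powr (1/4)) * cmod (\<sigma> y) \<le> cmod (deriv \<sigma> y)"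
      by (simp add: left_diff_distrib)
    moreover have "1 * cmod (\<sigma> y) \<le> (a * sqrt r - C / c * r powr (1/4)) * cmod (\<sigma> y)"
      using est by (intro mult_right_mono) auto
    ultimately show deriv: "cmod (\<sigma> y) \<le> cmod (deriv \<sigma> y)" by linarith
    define M where "M = C * exp (3 * a) * q"
    have M: "cmod (\<sigma> x) \<le> M" if x: "cmod (x - y) \<le> 1 / r" for x
    proof -
      have "Q x \<le> Q y + a * cmod (x - y) * (2 * r + cmod (x - y))"
        using Q_shift[of y "x - y"] by (simp add: r_def)
      also have "\<dots> \<le> Q y + a * (1 / r) * (2 * r + 1 / r)"
        using x ap r1 by (intro add_left_mono mult_mono) auto
      also have "a * (1 / r) * (2 * r + 1 / r) = a * (2 + 1 / r ^ 2)"
        using r1 by (simp add: field_simps power2_eq_square)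
      also have "\<dots> \<le> a * 3" using ap r1 by (intro mult_left_mono) (auto simp: field_simps)
      finally have "exp (Q x) \<le> exp (3 * a) * q" by (simp add: q_def mult.commute flip: exp_add)
      then have "C * exp (Q x) \<le> M" using C unfolding M_def mult.assoc by (intro mult_left_mono) auto
      with up[of x] show ?thesis by linarith
    qed
    have second: "cmod (deriv (deriv \<sigma>) u) \<le> 8 * M * r\<^sup>2" if u: "cmod (u - y) < 1 / (2 * r)" for u
    proof -
      have "cmod (deriv (deriv \<sigma>) u) \<le> 2 * M / (1 / (2 * r))\<^sup>2"
      proof (rule second_derivative_bound[OF sigma_holomorphic])
        fix x assume "cmod (x - u) \<le> 1 / (2 * r)"
        then have "cmod (x - y) \<le> 1 / (2 * r) + 1 / (2 * r)"
          using u norm_triangle_ineq[of "x - u" "u - y"] by simp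
        also have "\<dots> = 1 / r" by simp
        finally show "cmod (\<sigma> x) \<le> M" by (rule M)
      qed (use r1 in auto)
      then show ?thesis by (simp add: power_mult_distrib power_divide field_simps)
    qed
    define \<rho> where "\<rho> = 1 / r ^ 3"
    have "2 * r \<le> r ^ 3"
      using mult_mono[of 2 r r "r * r"] mult_mono[of 1 r r r] r2 by (simp add: power3_eq_cube)
    then have \<rho>: "\<rho> \<le> 1 / (2 * r)" using r1 unfolding \<rho>_def by (intro divide_left_mono) auto
    have close: "cmod (deriv \<sigma> u - deriv \<sigma> y) \<le> cmod (deriv \<sigma> y) / 2" if u: "u \<in> ball y \<rho>" for u
    proof -
      have der: "(deriv \<sigma> has_field_derivative deriv (deriv \<sigma>) x) (at x)" for x
        using holomorphic_deriv[OF sigma_holomorphic open_UNIV] by (simp add: holomorphic_derivI)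
      have "cmod (deriv \<sigma> u - deriv \<sigma> y) \<le> 8 * M * r\<^sup>2 * cmod (u - y)"
      proof (rule field_differentiable_bound[OF convex_ball[of y \<rho>]])
        show "(deriv \<sigma> has_field_derivative deriv (deriv \<sigma>) x) (at x within ball y \<rho>)" for x
          by (rule has_field_derivative_at_within[OF der])
        show "cmod (deriv (deriv \<sigma>) x) \<le> 8 * M * r\<^sup>2" if "x \<in> ball y \<rho>" for x
          using that \<rho> by (intro second) (auto simp: dist_norm norm_minus_commute)
        show "y \<in> ball y \<rho>" using r1 by (auto simp: \<rho>_def)
      qed (rule u)
      also have "\<dots> \<le> 8 * M * r\<^sup>2 * (1 / r ^ 3)"
        using u C q unfolding M_def
        by (intro mult_left_mono) (auto simp: \<rho>_def dist_norm norm_minus_commute)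
      also have "\<dots> = 8 * C * exp (3 * a) / r * q"
        using r1 by (simp add: M_def power2_eq_square power3_eq_cube)
      also have "\<dots> \<le> 8 * C * exp (3 * a) / r * (cmod (\<sigma> y) * r powr (1/4) / c)"
        using C r1 by (intro mult_left_mono q_le) auto
      also have "\<dots> = (8 * C * exp (3 * a) / c * r powr (1/4) / r) * cmod (\<sigma> y)" by (simp add: mult_ac)
      also have "\<dots> \<le> 1 / 2 * cmod (\<sigma> y)" using est by (intro mult_right_mono) auto
      finally show ?thesis using deriv by simp
    qed
    show "cmod (\<sigma> y) / 2 * dist x1 x2 \<le> dist (\<sigma> x1) (\<sigma> x2)"
      if "x1 \<in> ball y (1 / cmod y ^ 3)" "x2 \<in> ball y (1 / cmod y ^ 3)" for x1 x2
    proof -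
      have "cmod (\<sigma> y) / 2 * dist x1 x2 \<le> cmod (deriv \<sigma> y) / 2 * dist x1 x2"
        using deriv by (intro mult_right_mono) auto
      also have "\<dots> \<le> dist (\<sigma> x1) (\<sigma> x2)"
        using that by (intro almost_linear_imp_expanding[OF sigma_holomorphic close]) (auto simp: \<rho>_def r_def)
      finally show ?thesis .
    qed
  qed
qed

definition expanding_from :: "real \<Rightarrow> bool" where
  "expanding_from r0 \<longleftrightarrow> r0 \<ge> 1 \<and> (\<forall>y. cmod y \<ge> r0 \<and> \<not> bad y \<longrightarrow>
      exp (a / 4 * cmod y) \<le> cmod (\<sigma> y) \<and> 2 * cmod y \<le> cmod (\<sigma> y) \<and>
      cmod (\<sigma> y) \<le> cmod (deriv \<sigma> y) \<and>
      (\<forall>x\<in>ball y (1 / cmod y ^ 3). cmod (\<sigma> y) / 2 * dist y x \<le> dist (\<sigma> y) (\<sigma> x)))"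

lemma expanding_from_exists: "\<exists>r0. expanding_from r0"
proof -
  obtain r0 where r0: "r0 \<ge> 1"
    "\<And>y. cmod y \<ge> r0 \<Longrightarrow> \<not> bad y \<Longrightarrow> exp (a / 4 * cmod y) \<le> cmod (\<sigma> y)"
    "\<And>y. cmod y \<ge> r0 \<Longrightarrow> \<not> bad y \<Longrightarrow> 2 * cmod y \<le> cmod (\<sigma> y)"
    "\<And>y. cmod y \<ge> r0 \<Longrightarrow> \<not> bad y \<Longrightarrow> cmod (\<sigma> y) \<le> cmod (deriv \<sigma> y)"
    "\<And>y x1 x2. cmod y \<ge> r0 \<Longrightarrow> \<not> bad y \<Longrightarrow> x1 \<in> ball y (1 / cmod y ^ 3) \<Longrightarrow> x2 \<in> ball y (1 / cmod y ^ 3) \<Longrightarrow>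
       cmod (\<sigma> y) / 2 * dist x1 x2 \<le> dist (\<sigma> x1) (\<sigma> x2)"
    by (rule good_point_estimates) (rule that, assumption+)
  have "cmod (\<sigma> y) / 2 * dist y x \<le> dist (\<sigma> y) (\<sigma> x)"
    if "cmod y \<ge> r0" "\<not> bad y" "x \<in> ball y (1 / cmod y ^ 3)" for x y
  proof (rule r0(5)[OF that(1,2) _ that(3)])
    have "cmod y > 0" using that(1) r0(1) by linarith
    then show "y \<in> ball y (1 / cmod y ^ 3)" by simp
  qed
  then show ?thesis unfolding expanding_from_def using r0(1-4) by blast
qed

section \<open>Areas in dyadic annuli\<close>

definition shell :: "nat \<Rightarrow> complex set" where
  "shell k = {z. 2 ^ k \<le> cmod z \<and> cmod z < 2 ^ (k + 1)}"

text \<open>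
  With s^4 = 2 the quantities 2^(3 k / 2), 2^(7 k / 4) and 2^(k / 4) become the integral powers s^(6 k),
  s^(7 k) and s^k.
\<close>
definition s :: real where "s = 2 powr (1 / 4)"

lemma s_gt_1: "s > 1" by (simp add: s_def)

lemma s_power_4: "s ^ 4 = 2" by (simp add: s_def powr_power)

lemma two_power_eq: "2 ^ k = s ^ (4 * k)"
  by (simp add: power_mult s_power_4)

lemma borel_shell [measurable]: "shell k \<in> sets borel"
  unfolding shell_def by measurable

lemma borel_bad [measurable]: "Measurable.pred borel bad"
proof -
  have "{z. \<exists>w\<in>\<Lambda>. cmod (z - w) ^ 4 * cmod z < 1} = (\<Union>w\<in>\<Lambda>. {z. cmod (z - w) ^ 4 * cmod z < 1})" by auto
  moreover have "open \<dots>"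
    by (intro open_UN ballI open_Collect_less continuous_intros)
  ultimately have [measurable]: "Measurable.pred borel (\<lambda>z. \<exists>w\<in>\<Lambda>. cmod (z - w) ^ 4 * cmod z < 1)"
    by (simp add: pred_def)
  show ?thesis unfolding bad_def by measurable
qed

lemma measurable_sigma [measurable]: "\<sigma> \<in> borel_measurable borel"
  by (intro borel_measurable_continuous_onI holomorphic_on_imp_continuous_on sigma_holomorphic)

lemma card_lattice_ball:
  assumes "r \<ge> 0"
  shows "real (card {w \<in> \<Lambda>. cmod w \<le> r}) \<le> (2 * \<kappa> * r + 1)\<^sup>2"
proof -
  let ?N = "\<lfloor>\<kappa> * r\<rfloor>"
  have N: "0 \<le> ?N" using assms kappa_ge_1 by simp
  have "{w \<in> \<Lambda>. cmod w \<le> r} \<subseteq> (\<lambda>(m,n). of_int m + of_int n * \<tau>) ` ({-?N..?N} \<times> {-?N..?N})"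
  proof
    fix w assume w: "w \<in> {w \<in> \<Lambda>. cmod w \<le> r}"
    then obtain m n where mn: "w = of_int m + of_int n * \<tau>" by (auto elim: latticeE)
    have "\<kappa> * cmod w \<le> \<kappa> * r" using w kappa_ge_1 by auto
    then have "\<bar>real_of_int m\<bar> \<le> \<kappa> * r" "\<bar>real_of_int n\<bar> \<le> \<kappa> * r"
      using int_coordinates_le[where m = m and n = n] unfolding mn by linarith+
    then have "\<bar>m\<bar> \<le> ?N" "\<bar>n\<bar> \<le> ?N" by (simp_all add: le_floor_iff)
    then show "w \<in> (\<lambda>(m,n). of_int m + of_int n * \<tau>) ` ({-?N..?N} \<times> {-?N..?N})"
      by (intro image_eqI[of _ _ "(m, n)"]) (auto simp: mn)
  qed
  then have "card {w \<in> \<Lambda>. cmod w \<le> r} \<le> card ({-?N..?N} \<times> {-?N..?N})"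
    by (intro surj_card_le) auto
  also have "\<dots> = nat (2 * ?N + 1) ^ 2" using N by (simp add: card_cartesian_product power2_eq_square)
  finally have "real (card {w \<in> \<Lambda>. cmod w \<le> r}) \<le> real (nat (2 * ?N + 1) ^ 2)"
    by (simp only: of_nat_le_iff)
  also have "\<dots> = (2 * of_int ?N + 1)\<^sup>2" using N by simp
  also have "\<dots> \<le> (2 * \<kappa> * r + 1)\<^sup>2" using N of_int_floor_le[of "\<kappa> * r"] by (intro power_mono) auto
  finally show ?thesis .
qed

text \<open>
  The strip around the line has width O(2^(k / 2)) and length O(2^k). There are O(4^k) lattice points to
  consider, each with a disc of area at most \<pi> 2^(-k / 2).
\<close>
lemma bad_area:
  obtains C where "C > 0" "\<And>k. emeasure lborel {z \<in> shell k. bad z} \<le> ennreal (C * s ^ (6 * k))"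
proof
  define C where "C = 64 * pi + 81 * \<kappa>\<^sup>2 * pi"
  show "C > 0" unfolding C_def by (intro add_pos_nonneg) auto
  fix k
  define A where "A = {z \<in> shell k. (Re (v * z))\<^sup>2 < cmod z}"
  define B where "B = {z \<in> shell k. \<exists>w\<in>\<Lambda>. cmod (z - w) ^ 4 * cmod z < 1}"
  define p where "p = s ^ (2 * (k + 1))"
  define r where "r = s ^ (4 * (k + 1))"
  have pr: "p > 0" "r > 0" "p\<^sup>2 = r" "r = 2 ^ (k + 1)"
  proof -
    have "p\<^sup>2 = s ^ (2 * (k + 1) * 2)" unfolding p_def by (rule power_mult[symmetric])
    also have "2 * (k + 1) * 2 = 4 * (k + 1)" by simp
    finally show "p\<^sup>2 = r" unfolding r_def .
    show "p > 0" "r > 0" using s_gt_1 by (simp_all add: p_def r_def)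
    show "r = 2 ^ (k + 1)" unfolding two_power_eq r_def ..
  qed
  let ?E = "cbox (Complex (- p) (- r)) (Complex p r)"
  \<comment> \<open>Rotating by v puts the strip into a coordinate rectangle; an isometry is expanding with constant 1.\<close>
  have "emeasure lborel A \<le> ennreal (4 * pi / 1\<^sup>2) * emeasure lborel ?E"
  proof (rule emeasure_expanding_le[where f = "\<lambda>z. v * z"])
    show "(\<lambda>z. v * z) ` A \<subseteq> ?E"
    proof safe
      fix z assume z: "z \<in> A"
      then have "cmod z \<le> r" by (auto simp: A_def shell_def pr(4))
      then have "\<bar>Im (v * z)\<bar> \<le> r" using abs_Im_le_cmod[of "v * z"] by (simp add: norm_mult)
      moreover have "(Re (v * z))\<^sup>2 \<le> p\<^sup>2" using z \<open>cmod z \<le> r\<close> by (auto simp: A_def pr(3))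
      then have "\<bar>Re (v * z)\<bar> \<le> p" using pr(1) by (simp add: abs_le_square_iff[symmetric])
      ultimately show "v * z \<in> ?E" by (simp add: in_cbox_complex_iff abs_le_iff del: times_complex.sel)
    qed
    show "1 * dist x y \<le> dist (v * x) (v * y)" for x y
      by (simp add: dist_norm norm_mult flip: right_diff_distrib)
  qed auto
  also have "emeasure lborel ?E = ennreal (2 * p * (2 * r))"
    using pr by (subst emeasure_lborel_cbox) (auto simp: Basis_complex_def)
  also have "ennreal (4 * pi / 1\<^sup>2) * \<dots> = ennreal (16 * pi * (p * r))"
    using pr by (subst ennreal_mult[symmetric]) (auto simp: mult_ac)
  also have "\<dots> \<le> ennreal (64 * pi * s ^ (6 * k))"
  proof (rule ennreal_leI)
    have "p * r = s ^ 6 * s ^ (6 * k)" 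
      unfolding p_def r_def power_add[symmetric] by (rule arg_cong[where f = "power s"]) simp
    moreover have "s ^ 6 \<le> s ^ 8" using s_gt_1 by (intro power_increasing) auto
    moreover have "s ^ 8 = 4" using two_power_eq[of 2] by simp
    ultimately show "16 * pi * (p * r) \<le> 64 * pi * s ^ (6 * k)" using s_gt_1 by simp
  qed
  finally have A: "emeasure lborel A \<le> ennreal (64 * pi * s ^ (6 * k))" .
  let ?L = "{w \<in> \<Lambda>. cmod w \<le> 4 * 2 ^ k}"
  have B_sub: "B \<subseteq> (\<Union>w\<in>?L. cball w (1 / s ^ k))"
  proof
    fix z assume z: "z \<in> B"
    then obtain w where w: "w \<in> \<Lambda>" "cmod (z - w) ^ 4 * cmod z < 1" by (auto simp: B_def)
    have "cmod (z - w) ^ 4 * 2 ^ k \<le> cmod (z - w) ^ 4 * cmod z"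
      using z by (intro mult_left_mono) (auto simp: B_def shell_def)
    then have "cmod (z - w) ^ 4 \<le> 1 / 2 ^ k" using w(2) by (simp add: field_simps)
    also have "1 / 2 ^ k = (1 / s ^ k) ^ 4"
      unfolding two_power_eq by (simp add: power_divide mult.commute flip: power_mult)
    finally have le: "cmod (z - w) \<le> 1 / s ^ k" using s_gt_1 by (subst (asm) power_mono_iff) auto
    also have "\<dots> \<le> 1" using s_gt_1 by (simp add: one_le_power)
    finally have "cmod w \<le> cmod z + 1" using norm_triangle_ineq2[of w z] by (simp add: norm_minus_commute)
    also have "\<dots> \<le> 2 * 2 ^ k + 1 * 2 ^ k" using z by (intro add_mono) (auto simp: B_def shell_def)
    also have "\<dots> \<le> 4 * 2 ^ k" by simp
    finally have "w \<in> ?L" using w(1) by blast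
    then show "z \<in> (\<Union>w\<in>?L. cball w (1 / s ^ k))" using le by (auto simp: dist_norm norm_minus_commute)
  qed
  have "emeasure lborel B \<le> emeasure lborel (\<Union>w\<in>?L. cball w (1 / s ^ k))"
    using lattice_ball_finite by (intro emeasure_mono B_sub) auto
  also have "\<dots> \<le> (\<Sum>w\<in>?L. emeasure lborel (cball w (1 / s ^ k)))"
    using lattice_ball_finite by (intro emeasure_subadditive_finite) auto
  also have "\<dots> = (\<Sum>w\<in>?L. ennreal (pi / s ^ (2 * k)))"
    using s_gt_1 by (intro sum.cong, simp, subst emeasure_cball)
      (auto simp: unit_ball_vol_2 power_divide mult.commute ennreal_mult[symmetric] simp flip: power_mult)
  also have "\<dots> = ennreal (real (card ?L) * (pi / s ^ (2 * k)))"
    using s_gt_1 by (subst ennreal_mult) (simp_all add: ennreal_of_nat_eq_real_of_nat)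
  also have "\<dots> \<le> ennreal (81 * \<kappa>\<^sup>2 * pi * s ^ (6 * k))"
  proof (rule ennreal_leI)
    have "real (card ?L) \<le> (2 * \<kappa> * (4 * 2 ^ k) + 1)\<^sup>2" by (rule card_lattice_ball) simp
    also have "\<dots> \<le> (9 * \<kappa> * 2 ^ k)\<^sup>2"
    proof (rule power_mono)
      have "1 * 1 \<le> \<kappa> * 2 ^ k" using kappa_ge_1 by (intro mult_mono) auto
      then show "2 * \<kappa> * (4 * 2 ^ k) + 1 \<le> 9 * \<kappa> * 2 ^ k" by simp
    qed (use kappa_ge_1 in auto)
    also have "\<dots> = 81 * \<kappa>\<^sup>2 * s ^ (8 * k)"
      unfolding two_power_eq by (simp add: power_mult_distrib flip: power_mult)
    finally have "real (card ?L) * (pi / s ^ (2 * k)) \<le> 81 * \<kappa>\<^sup>2 * s ^ (8 * k) * (pi / s ^ (2 * k))"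
      using s_gt_1 by (intro mult_right_mono) auto
    also have "s ^ (8 * k) = s ^ (6 * k) * s ^ (2 * k)" by (simp flip: power_add)
    finally show "real (card ?L) * (pi / s ^ (2 * k)) \<le> 81 * \<kappa>\<^sup>2 * pi * s ^ (6 * k)"
      using s_gt_1 by (simp add: mult_ac)
  qed
  finally have B: "emeasure lborel B \<le> ennreal (81 * \<kappa>\<^sup>2 * pi * s ^ (6 * k))" .
  have AB: "{z \<in> shell k. bad z} = A \<union> B" by (auto simp: bad_def A_def B_def)
  have "A \<in> sets borel" unfolding A_def by measurable
  moreover have "B \<in> sets borel"
  proof -
    have "B = shell k \<inter> (\<Union>w\<in>\<Lambda>. {z. cmod (z - w) ^ 4 * cmod z < 1})" by (auto simp: B_def)
    moreover have "open (\<Union>w\<in>\<Lambda>. {z. cmod (z - w) ^ 4 * cmod z < 1})"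
      by (intro open_UN ballI open_Collect_less continuous_intros)
    ultimately show ?thesis by auto
  qed
  ultimately have "emeasure lborel {z \<in> shell k. bad z} \<le> emeasure lborel A + emeasure lborel B"
    unfolding AB by (intro emeasure_subadditive) auto
  also have "\<dots> \<le> ennreal (64 * pi * s ^ (6 * k)) + ennreal (81 * \<kappa>\<^sup>2 * pi * s ^ (6 * k))"
    by (intro add_mono A B)
  also have "\<dots> = ennreal (C * s ^ (6 * k))"
    using s_gt_1 by (subst ennreal_plus[symmetric]) (auto simp: C_def distrib_right)
  finally show "emeasure lborel {z \<in> shell k. bad z} \<le> ennreal (C * s ^ (6 * k))" .
qed

definition pull :: "real \<Rightarrow> complex set \<Rightarrow> complex set" where
  "pull r0 E = {y. r0 \<le> cmod y \<and> \<not> bad y \<and> \<sigma> y \<in> E}"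

lemma borel_pull [measurable]: "E \<in> sets borel \<Longrightarrow> pull r0 E \<in> sets borel"
proof -
  assume "E \<in> sets borel"
  then have "\<sigma> -` E \<in> sets borel" using measurable_sets_borel[OF measurable_sigma] by blast
  moreover have "{y. r0 \<le> cmod y \<and> \<not> bad y} \<in> sets borel" by measurable
  moreover have "pull r0 E = {y. r0 \<le> cmod y \<and> \<not> bad y} \<inter> \<sigma> -` E" by (auto simp: pull_def)
  ultimately show ?thesis by simp
qed

text \<open>
  A good preimage y satisfies exp(a |y| / 4) < 2^(k + 1), so |y| \<le> l = J k. In a square of side
  1 / (2 l^3) any two points have distance less than |y|^(-3), so \<sigma> expands by 2^k / 2 on the part of the preimage in
  that square. There are at most 25 l^8 such squares.
\<close>
lemma pull_shell:
  assumes r0: "expanding_from r0"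
  shows "eventually (\<lambda>k. \<forall>E. E \<in> sets borel \<and> E \<subseteq> shell k \<longrightarrow>
     emeasure lborel (pull r0 E) \<le> ennreal (1 / s ^ (7 * k)) * emeasure lborel E) sequentially"
proof -
  define J where "J = nat \<lceil>8 / a\<rceil> + 1"
  have J: "8 / a \<le> real J" "J \<ge> 1" unfolding J_def by linarith+
  \<comment> \<open>400 = 25 * 16, from 25 l^8 squares and the area factor 4 \<pi> / (2^k / 2)^2.\<close>
  have "eventually (\<lambda>k. real k \<ge> 1 \<and> 400 * pi * real J ^ 8 * real k ^ 8 \<le> s ^ k) sequentially"
  proof -
    have "eventually (\<lambda>k. 400 * pi * real J ^ 8 * real k ^ 8 \<le> s ^ k) sequentially"
      using s_gt_1 J(2) by real_asymp
    then show ?thesis using eventually_ge_at_top[of 1] by eventually_elim auto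
  qed
  then show ?thesis
  proof eventually_elim
    case (elim k)
    then have k: "k \<ge> 1" and big: "400 * pi * real J ^ 8 * real k ^ 8 \<le> s ^ k" by auto
    show ?case
    proof (intro allI impI)
      fix E assume E: "E \<in> sets borel \<and> E \<subseteq> shell k"
      then have [measurable]: "E \<in> sets borel" by simp
      define l where "l = J * k"
      have l: "l \<ge> 1" using k J(2) by (simp add: l_def)
      have y_le: "cmod y \<le> real l" if "y \<in> pull r0 E" for y
      proof -
        have "exp (a / 4 * cmod y) \<le> cmod (\<sigma> y)"
          using that r0 by (auto simp: pull_def expanding_from_def)
        also have "\<dots> \<le> 2 ^ (k + 1)" using that E by (auto simp: pull_def shell_def)
        also have "\<dots> \<le> exp 1 ^ (k + 1)" using exp_ge_add_one_self[of 1] by (intro power_mono) auto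
        also have "\<dots> = exp (real (k + 1))" using exp_of_nat_mult[of "k + 1" "1::real"] by simp
        finally have "a / 4 * cmod y \<le> real (k + 1)" by simp
        also have "\<dots> \<le> 2 * real k" using k by simp
        finally have "cmod y \<le> 8 / a * real k" using a_pos by (simp add: field_simps)
        also have "\<dots> \<le> real J * real k" by (intro mult_right_mono J) auto
        finally show ?thesis by (simp add: l_def)
      qed
      define I where "I = {- (2 * int l ^ 4)..2 * int l ^ 4} \<times> {- (2 * int l ^ 4)..2 * int l ^ 4}"
      define X where "X = (\<lambda>(p, q). {y \<in> pull r0 E. real_of_int p \<le> 2 * real l ^ 3 * Re y \<and> 2 * real l ^ 3 * Re y < real_of_int p + 1 \<and>
             real_of_int q \<le> 2 * real l ^ 3 * Im y \<and> 2 * real l ^ 3 * Im y < real_of_int q + 1})"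
      have X_borel: "X i \<in> sets borel" for i
      proof -
        have "{y \<in> space borel. y \<in> pull r0 E \<and> real_of_int p \<le> 2 * real l ^ 3 * Re y \<and> 2 * real l ^ 3 * Re y < real_of_int p + 1 \<and>
             real_of_int q \<le> 2 * real l ^ 3 * Im y \<and> 2 * real l ^ 3 * Im y < real_of_int q + 1} \<in> sets borel" for p q
          by measurable
        then show ?thesis unfolding X_def by (cases i) simp
      qed
      have cover: "pull r0 E \<subseteq> (\<Union>i\<in>I. X i)"
      proof
        fix y assume y: "y \<in> pull r0 E"
        have fl: "\<lfloor>2 * real l ^ 3 * t\<rfloor> \<in> {- (2 * int l ^ 4)..2 * int l ^ 4}" if "\<bar>t\<bar> \<le> real l" for t
        proof -
          have "\<bar>2 * real l ^ 3 * t\<bar> \<le> 2 * real l ^ 3 * real l"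
            using that by (simp add: abs_mult mult_left_mono)
          also have "\<dots> = 2 * real l ^ 4" by (simp add: power3_eq_cube power4_eq_xxxx)
          finally have "2 * real l ^ 3 * t \<le> real_of_int (2 * int l ^ 4)" "real_of_int (- (2 * int l ^ 4)) \<le> 2 * real l ^ 3 * t"
            by (simp_all only: abs_le_iff of_int_minus of_int_mult of_int_power of_int_numeral of_int_of_nat_eq) linarith+
          then show ?thesis unfolding atLeastAtMost_iff le_floor_iff floor_le_iff by linarith
        qed
        have "\<bar>Re y\<bar> \<le> real l" "\<bar>Im y\<bar> \<le> real l"
          using y_le[OF y] abs_Re_le_cmod[of y] abs_Im_le_cmod[of y] by linarith+
        then have "(\<lfloor>2 * real l ^ 3 * Re y\<rfloor>, \<lfloor>2 * real l ^ 3 * Im y\<rfloor>) \<in> I"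
          unfolding I_def by (intro SigmaI fl)
        moreover have "y \<in> X (\<lfloor>2 * real l ^ 3 * Re y\<rfloor>, \<lfloor>2 * real l ^ 3 * Im y\<rfloor>)"
          using y unfolding X_def prod.case mem_Collect_eq by (intro conjI) (assumption | rule of_int_floor_le real_of_int_floor_add_one_gt)+
        ultimately show "y \<in> (\<Union>i\<in>I. X i)" by blast
      qed
      have X_le: "emeasure lborel (X i) \<le> ennreal (16 * pi / s ^ (8 * k)) * emeasure lborel E" for i
      proof -
        obtain p q where i: "i = (p, q)" by (cases i)
        have "emeasure lborel (X i) \<le> ennreal (4 * pi / (2 ^ k / 2)\<^sup>2) * emeasure lborel E"
        proof (rule emeasure_expanding_le)
          show "bounded E"
            by (rule bounded_subset[OF bounded_ball[of 0 "2 ^ (k + 1)"]]) (use E in \<open>auto simp: shell_def\<close>)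
          show "\<sigma> ` X i \<subseteq> E" by (auto simp: X_def i pull_def)
          fix x y assume xy: "x \<in> X i" "y \<in> X i"
          then have x: "x \<in> pull r0 E" by (simp add: X_def i)
          then have x0: "cmod x > 0" and sx: "cmod (\<sigma> x) \<ge> 2 ^ k"
            using r0 E by (auto simp: pull_def expanding_from_def shell_def)
          have "2 * real l ^ 3 * \<bar>Re (x - y)\<bar> < 1" "2 * real l ^ 3 * \<bar>Im (x - y)\<bar> < 1"
            using xy by (auto simp: X_def i abs_if algebra_simps)
          then have "real l ^ 3 * (\<bar>Re (x - y)\<bar> + \<bar>Im (x - y)\<bar>) < 1" unfolding distrib_left by linarith
          moreover have "cmod x ^ 3 * cmod (x - y) \<le> real l ^ 3 * (\<bar>Re (x - y)\<bar> + \<bar>Im (x - y)\<bar>)"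
            using y_le[OF x] by (intro mult_mono power_mono cmod_le) auto
          ultimately have "cmod (x - y) < 1 / cmod x ^ 3" using x0 by (simp add: field_simps)
          then have "y \<in> ball x (1 / cmod x ^ 3)" by (simp add: dist_norm)
          then have "cmod (\<sigma> x) / 2 * dist x y \<le> dist (\<sigma> x) (\<sigma> y)"
            using r0 x by (auto simp: expanding_from_def pull_def)
          moreover have "2 ^ k / 2 * dist x y \<le> cmod (\<sigma> x) / 2 * dist x y"
            using sx by (intro mult_right_mono) auto
          ultimately show "2 ^ k / 2 * dist x y \<le> dist (\<sigma> x) (\<sigma> y)" by linarith
        qed auto
        also have "4 * pi / (2 ^ k / 2)\<^sup>2 = 16 * pi / s ^ (8 * k)"
          unfolding two_power_eq by (simp add: power_divide flip: power_mult)
        finally show ?thesis .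
      qed
      have fin: "finite I" by (simp add: I_def)
      have cardI: "real (card I) \<le> 25 * real l ^ 8"
      proof -
        have "card I = (4 * l ^ 4 + 1)\<^sup>2"
          unfolding I_def by (simp add: card_cartesian_product power2_eq_square nat_add_distrib nat_mult_distrib nat_power_eq)
        then have "real (card I) = (4 * real l ^ 4 + 1)\<^sup>2" by simp
        also have "\<dots> \<le> (5 * real l ^ 4)\<^sup>2" using l by (intro power_mono) auto
        also have "\<dots> = 25 * real l ^ 8" by (simp add: power_mult_distrib flip: power_mult)
        finally show ?thesis .
      qed
      have "emeasure lborel (pull r0 E) \<le> emeasure lborel (\<Union>i\<in>I. X i)"
        using fin X_borel by (intro emeasure_mono cover) auto
      also have "\<dots> \<le> (\<Sum>i\<in>I. emeasure lborel (X i))"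
        using fin X_borel by (intro emeasure_subadditive_finite) auto
      also have "\<dots> \<le> (\<Sum>i\<in>I. ennreal (16 * pi / s ^ (8 * k)) * emeasure lborel E)"
        by (intro sum_mono X_le)
      also have "\<dots> = ennreal (real (card I) * (16 * pi / s ^ (8 * k))) * emeasure lborel E"
        using s_gt_1 by (subst ennreal_mult) (simp_all add: ennreal_of_nat_eq_real_of_nat mult.assoc)
      also have "\<dots> \<le> ennreal (1 / s ^ (7 * k)) * emeasure lborel E"
      proof (intro mult_right_mono ennreal_leI)
        have "real (card I) * (16 * pi / s ^ (8 * k)) \<le> 25 * real l ^ 8 * (16 * pi / s ^ (8 * k))"
          using s_gt_1 by (intro mult_right_mono cardI) auto
        also have "\<dots> = (400 * pi * real J ^ 8 * real k ^ 8) / s ^ (8 * k)"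
          by (simp add: l_def power_mult_distrib)
        also have "\<dots> \<le> s ^ k / s ^ (8 * k)" using s_gt_1 by (intro divide_right_mono big) auto
        also have "\<dots> = s ^ k / (s ^ k * s ^ (7 * k))" by (simp flip: power_add)
        also have "\<dots> = 1 / s ^ (7 * k)" using s_gt_1 by simp
        finally show "real (card I) * (16 * pi / s ^ (8 * k)) \<le> 1 / s ^ (7 * k)" .
      qed auto
      finally show "emeasure lborel (pull r0 E) \<le> ennreal (1 / s ^ (7 * k)) * emeasure lborel E" .
    qed
  qed
qed

section \<open>Orbits that are never bad\<close>

definition far :: "nat \<Rightarrow> complex set" where "far m = {z. 2 ^ m \<le> cmod z}"

lemma borel_far [measurable]: "far m \<in> sets borel"
  unfolding far_def by measurable

lemma far_eq_shells: "far m = (\<Union>k. shell (m + k))"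
proof (intro equalityI subsetI)
  fix z assume z: "z \<in> far m"
  have "\<exists>k. cmod z < 2 ^ k" using real_arch_pow[of 2 "cmod z"] by auto
  then have least: "cmod z < 2 ^ (LEAST k. cmod z < 2 ^ k)" by (rule LeastI_ex)
  define k where "k = (LEAST k. cmod z < 2 ^ k)"
  have "m < k"
  proof (rule ccontr)
    assume "\<not> m < k"
    then have "(2::real) ^ k \<le> 2 ^ m" by (intro power_increasing) auto
    moreover have "2 ^ m \<le> cmod z" using z by (simp add: far_def)
    ultimately show False using least unfolding k_def by linarith
  qed
  then obtain j where j: "k = Suc (m + j)" using less_imp_Suc_add by blast
  have "\<not> cmod z < 2 ^ (m + j)" using not_less_Least[of "m + j" "\<lambda>k. cmod z < 2 ^ k"] j by (simp add: k_def)
  then have "z \<in> shell (m + j)" using least j by (simp add: shell_def k_def[symmetric])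
  then show "z \<in> (\<Union>k. shell (m + k))" by blast
next
  fix z assume "z \<in> (\<Union>k. shell (m + k))"
  then obtain k where "2 ^ (m + k) \<le> cmod z" by (auto simp: shell_def)
  moreover have "(2::real) ^ m \<le> 2 ^ (m + k)" by (intro power_increasing) auto
  ultimately show "z \<in> far m" unfolding far_def mem_Collect_eq by linarith
qed

lemma disjoint_shells: "k \<noteq> j \<Longrightarrow> shell k \<inter> shell j = {}"
proof -
  have *: "shell k \<inter> shell j = {}" if "k < j" for k j
  proof -
    have "(2::real) ^ (k + 1) \<le> 2 ^ j" using that by (intro power_increasing) auto
    then show ?thesis by (auto simp: shell_def)
  qed
  assume "k \<noteq> j"
  then show ?thesis using *[of k j] *[of j k] by (cases "k < j") auto
qed

lemma emeasure_shells:
  assumes [measurable]: "E \<in> sets borel" and sub: "E \<subseteq> far m"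
  shows "emeasure lborel E = (\<Sum>k. emeasure lborel (E \<inter> shell (m + k)))"
    and "emeasure lborel (pull r E) = (\<Sum>k. emeasure lborel (pull r (E \<inter> shell (m + k))))"
proof -
  have E: "E = (\<Union>k. E \<inter> shell (m + k))" using sub unfolding far_eq_shells by blast
  have dis: "(E \<inter> shell (m + k)) \<inter> (E \<inter> shell (m + j)) = {}" if "k \<noteq> j" for k j
    using disjoint_shells[of "m + k" "m + j"] that by auto
  have "(\<Sum>k. emeasure lborel (E \<inter> shell (m + k))) = emeasure lborel (\<Union>k. E \<inter> shell (m + k))"
    using dis by (intro suminf_emeasure) (auto simp: disjoint_family_on_def)
  then show "emeasure lborel E = (\<Sum>k. emeasure lborel (E \<inter> shell (m + k)))" using E by simp
  have "pull r E = (\<Union>k. pull r (E \<inter> shell (m + k)))" by (subst E) (auto simp: pull_def)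
  moreover have "(\<Sum>k. emeasure lborel (pull r (E \<inter> shell (m + k)))) = emeasure lborel (\<Union>k. pull r (E \<inter> shell (m + k)))"
    using dis by (intro suminf_emeasure) (auto simp: disjoint_family_on_def pull_def)
  ultimately show "emeasure lborel (pull r E) = (\<Sum>k. emeasure lborel (pull r (E \<inter> shell (m + k))))" by simp
qed

definition contracting_from :: "nat \<Rightarrow> bool" where
  "contracting_from m \<longleftrightarrow> expanding_from (2 ^ m) \<and> (\<forall>k\<ge>m. \<forall>E. E \<in> sets borel \<and> E \<subseteq> shell k \<longrightarrow>
     emeasure lborel (pull (2 ^ m) E) \<le> ennreal (1 / s ^ (7 * k)) * emeasure lborel E)"

lemma contracting_from_expanding:
  assumes "contracting_from m" "2 ^ m \<le> cmod y" "\<not> bad y"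
  shows "exp (a / 4 * cmod y) \<le> cmod (\<sigma> y)" "2 * cmod y \<le> cmod (\<sigma> y)" "cmod (\<sigma> y) \<le> cmod (deriv \<sigma> y)"
  using assms unfolding contracting_from_def expanding_from_def by blast+

lemma contracting_from_pull:
  assumes "contracting_from m" "k \<ge> m" "E \<in> sets borel" "E \<subseteq> shell k"
  shows "emeasure lborel (pull (2 ^ m) E) \<le> ennreal (1 / s ^ (7 * k)) * emeasure lborel E"
  using assms unfolding contracting_from_def by blast

lemma contracting_from_exists: "\<exists>m. contracting_from m"
proof -
  obtain r0 where r0: "expanding_from r0" using expanding_from_exists by blast
  obtain k1 where k1: "\<And>k E. k \<ge> k1 \<Longrightarrow> E \<in> sets borel \<Longrightarrow> E \<subseteq> shell k \<Longrightarrow>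
     emeasure lborel (pull r0 E) \<le> ennreal (1 / s ^ (7 * k)) * emeasure lborel E"
    using pull_shell[OF r0] unfolding eventually_at_top_linorder by blast
  obtain k2 where k2: "r0 < 2 ^ k2" using real_arch_pow[of 2 r0] by auto
  define m where "m = max k1 k2"
  have "(2::real) ^ k2 \<le> 2 ^ m" unfolding m_def by (intro power_increasing) auto
  with k2 have m: "r0 \<le> 2 ^ m" by linarith
  have "expanding_from (2 ^ m)" using r0 m unfolding expanding_from_def by auto
  moreover have "emeasure lborel (pull (2 ^ m) E) \<le> ennreal (1 / s ^ (7 * k)) * emeasure lborel E"
    if "k \<ge> m" "E \<in> sets borel" "E \<subseteq> shell k" for k E
  proof -
    have "emeasure lborel (pull (2 ^ m) E) \<le> emeasure lborel (pull r0 E)"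
      using that m by (intro emeasure_mono) (auto simp: pull_def)
    also have "\<dots> \<le> ennreal (1 / s ^ (7 * k)) * emeasure lborel E"
      using that by (intro k1) (auto simp: m_def)
    finally show ?thesis .
  qed
  ultimately show ?thesis unfolding contracting_from_def by blast
qed

lemma pull_le:
  assumes m: "contracting_from m" and E: "E \<in> sets borel" "E \<subseteq> far m"
  shows "emeasure lborel (pull (2 ^ m) E) \<le> emeasure lborel E"
proof -
  have le: "emeasure lborel (pull (2 ^ m) (E \<inter> shell (m + k))) \<le> emeasure lborel (E \<inter> shell (m + k))" for k
  proof -
    have "emeasure lborel (pull (2 ^ m) (E \<inter> shell (m + k))) \<le> ennreal (1 / s ^ (7 * (m + k))) * emeasure lborel (E \<inter> shell (m + k))"
      using E(1) by (intro contracting_from_pull[OF m]) auto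
    also have "\<dots> \<le> 1 * emeasure lborel (E \<inter> shell (m + k))"
      using s_gt_1 by (intro mult_right_mono) (auto simp: one_le_power)
    finally show ?thesis by simp
  qed
  show ?thesis unfolding emeasure_shells[OF E] by (intro suminf_le le) auto
qed

lemma pull_iterate_le:
  assumes m: "contracting_from m" and E: "E \<in> sets borel" "E \<subseteq> far m"
  shows "(pull (2 ^ m) ^^ n) E \<in> sets borel \<and> (pull (2 ^ m) ^^ n) E \<subseteq> far m \<and>
    emeasure lborel ((pull (2 ^ m) ^^ n) E) \<le> emeasure lborel E"
proof (induction n)
  case (Suc n)
  let ?F = "(pull (2 ^ m) ^^ n) E"
  have "emeasure lborel (pull (2 ^ m) ?F) \<le> emeasure lborel ?F"
    using Suc by (intro pull_le[OF m]) auto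
  moreover have "pull (2 ^ m) ?F \<subseteq> far m" by (auto simp: pull_def far_def)
  ultimately show ?case using Suc by auto
qed (use E in auto)

text \<open>
  The area s^(6 k) of the bad points of an annulus is multiplied by s^(-7 k), which leaves the geometric
  series with ratio 1/s.
\<close>
lemma pull_bad_le:
  assumes m: "contracting_from m"
  obtains K where "K > 0" "\<And>j. j \<ge> m \<Longrightarrow> emeasure lborel (pull (2 ^ m) {z \<in> far j. bad z}) \<le> ennreal (K * (1 / s) ^ j)"
proof -
  obtain C where C: "C > 0" "\<And>k. emeasure lborel {z \<in> shell k. bad z} \<le> ennreal (C * s ^ (6 * k))"
    using bad_area by metis
  define K where "K = C / (1 - 1 / s)"
  have geo: "norm (1 / s) < 1" using s_gt_1 by simp
  show ?thesis
  proof
    show "K > 0" unfolding K_def using C(1) s_gt_1 by simp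
    fix j assume j: "j \<ge> m"
    define E where "E = {z \<in> far j. bad z}"
    have E: "E \<in> sets borel" unfolding E_def by measurable
    have E_far: "E \<subseteq> far j" unfolding E_def by auto
    have eq: "E \<inter> shell (j + k) = {z \<in> shell (j + k). bad z}" for k
      unfolding E_def using far_eq_shells[of j] by auto
    have "emeasure lborel (pull (2 ^ m) (E \<inter> shell (j + k))) \<le> ennreal (C * (1 / s) ^ j * (1 / s) ^ k)" for k
    proof -
      have "emeasure lborel (pull (2 ^ m) (E \<inter> shell (j + k))) \<le> ennreal (1 / s ^ (7 * (j + k))) * emeasure lborel (E \<inter> shell (j + k))"
        using j E(1) by (intro contracting_from_pull[OF m]) auto
      also have "\<dots> \<le> ennreal (1 / s ^ (7 * (j + k))) * ennreal (C * s ^ (6 * (j + k)))"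
        unfolding eq by (intro mult_left_mono C) auto
      also have "\<dots> = ennreal (1 / s ^ (7 * (j + k)) * (C * s ^ (6 * (j + k))))"
        using C(1) s_gt_1 by (intro ennreal_mult[symmetric]) auto
      also have "1 / s ^ (7 * (j + k)) * (C * s ^ (6 * (j + k))) = C * (1 / s) ^ j * (1 / s) ^ k"
      proof -
        have "s ^ (7 * (j + k)) = s ^ (6 * (j + k)) * s ^ j * s ^ k"
          unfolding power_add[symmetric] by (rule arg_cong[where f = "power s"]) simp
        then show ?thesis using s_gt_1 by (simp add: power_divide field_simps)
      qed
      finally show ?thesis .
    qed
    then have "emeasure lborel (pull (2 ^ m) E) \<le> (\<Sum>k. ennreal (C * (1 / s) ^ j * (1 / s) ^ k))"
      unfolding emeasure_shells(2)[OF E E_far] by (intro suminf_le) auto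
    also have "\<dots> = ennreal (\<Sum>k. C * (1 / s) ^ j * (1 / s) ^ k)"
      using C(1) s_gt_1 geo by (intro suminf_ennreal2 summable_mult summable_geometric) auto
    also have "(\<Sum>k. C * (1 / s) ^ j * (1 / s) ^ k) = C * (1 / s) ^ j * (1 / (1 - 1 / s))"
      by (simp only: suminf_mult[OF summable_geometric[OF geo]] suminf_geometric[OF geo])
    also have "\<dots> = K * (1 / s) ^ j" by (simp add: K_def)
    finally show "emeasure lborel (pull (2 ^ m) {z \<in> far j. bad z}) \<le> ennreal (K * (1 / s) ^ j)"
      unfolding E_def .
  qed
qed

lemma orbit_growth:
  assumes m: "contracting_from m" and j: "j \<ge> m" and z: "z \<in> far j"
    and good: "\<And>i. i < n \<Longrightarrow> \<not> bad ((\<sigma> ^^ i) z)"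
  shows "(\<sigma> ^^ n) z \<in> far (j + n)"
  using good
proof (induction n)
  case (Suc n)
  let ?y = "(\<sigma> ^^ n) z"
  have y: "2 ^ (j + n) \<le> cmod ?y" using Suc by (simp add: far_def)
  have "(2::real) ^ m \<le> 2 ^ (j + n)" using j by (intro power_increasing) auto
  with y have "2 ^ m \<le> cmod ?y" by linarith
  then have "2 * cmod ?y \<le> cmod (\<sigma> ?y)"
    using Suc.prems[of n] by (intro contracting_from_expanding(2)[OF m]) auto
  then show ?case using y by (simp add: far_def)
qed (use z in simp)

lemma pull_iterateI:
  assumes "\<And>i. i < n \<Longrightarrow> r \<le> cmod ((\<sigma> ^^ i) z) \<and> \<not> bad ((\<sigma> ^^ i) z)" "(\<sigma> ^^ n) z \<in> E"
  shows "z \<in> (pull r ^^ n) E"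
  using assms
proof (induction n arbitrary: z)
  case (Suc n)
  have "\<sigma> z \<in> (pull r ^^ n) E"
    using Suc.prems(1)[of "Suc _"] Suc.prems(2) by (intro Suc.IH) (auto simp: funpow_swap1)
  then have "z \<in> pull r ((pull r ^^ n) E)" using Suc.prems(1)[of 0] unfolding pull_def mem_Collect_eq by simp
  then show ?case by simp
qed simp

lemma measurable_sigma_funpow [measurable]: "(\<sigma> ^^ n) \<in> borel_measurable borel"
  by (induction n) (auto intro: measurable_comp[OF _ measurable_sigma] simp: id_def)

definition persistent :: "nat \<Rightarrow> complex set" where
  "persistent j = {z \<in> shell j. \<forall>n. \<not> bad ((\<sigma> ^^ n) z)}"

lemma borel_bad_funpow [measurable]: "Measurable.pred borel (\<lambda>z. bad ((\<sigma> ^^ n) z))"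
  by (rule measurable_compose[OF measurable_sigma_funpow borel_bad])

lemma borel_persistent [measurable]: "persistent j \<in> sets borel"
  unfolding persistent_def by measurable

lemma shell_area: "ennreal (s ^ (8 * k) / 4) \<le> emeasure lborel (shell k)"
proof -
  let ?t = "2 ^ k :: real"
  let ?B = "cbox (Complex ?t 0) (Complex (3 / 2 * ?t) (1 / 2 * ?t))"
  have "?B \<subseteq> shell k"
  proof
    fix z assume z: "z \<in> ?B"
    then have b: "?t \<le> Re z" "Re z \<le> 3 / 2 * ?t" "0 \<le> Im z" "Im z \<le> 1 / 2 * ?t"
      by (auto simp: in_cbox_complex_iff)
    have "?t \<le> cmod z" using b complex_Re_le_cmod[of z] by linarith
    moreover have "cmod z < 2 * ?t"
    proof (rule power2_less_imp_less)
      have "(cmod z)\<^sup>2 \<le> (3 / 2 * ?t)\<^sup>2 + (1 / 2 * ?t)\<^sup>2"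
        unfolding cmod_power2 using b zero_less_power[of "2::real" k] by (intro add_mono power_mono) linarith+
      also have "\<dots> < (2 * ?t)\<^sup>2" by (simp add: power_mult_distrib power_divide)
      finally show "(cmod z)\<^sup>2 < (2 * ?t)\<^sup>2" .
    qed simp
    ultimately show "z \<in> shell k" by (simp add: shell_def)
  qed
  then have "emeasure lborel ?B \<le> emeasure lborel (shell k)" by (intro emeasure_mono) auto
  moreover have "emeasure lborel ?B = ennreal (?t * ?t / 4)"
    by (subst emeasure_lborel_cbox) (auto simp: Basis_complex_def)
  moreover have "?t * ?t = s ^ (8 * k)" unfolding two_power_eq power_add[symmetric] by simp
  ultimately show ?thesis by simp
qed

text \<open>
  Outside the persistent set each point of the annulus has a first bad time n, and X n collects those
  points. For n \<ge> 1 the set X n lies in an n-fold good preimage of bad points of modulus at least 2^(j + n):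
  the innermost preimage gains a geometrically small area, the others do not increase it. The sum over n is
  smaller than the area of the annulus once j is large.
\<close>
lemma persistent_positive:
  assumes m: "contracting_from m"
  obtains j where "j \<ge> m" "emeasure lborel (persistent j) > 0"
proof -
  obtain C where C: "C > 0" "\<And>k. emeasure lborel {z \<in> shell k. bad z} \<le> ennreal (C * s ^ (6 * k))"
    using bad_area by metis
  obtain K where K: "K > 0" "\<And>j. j \<ge> m \<Longrightarrow> emeasure lborel (pull (2 ^ m) {z \<in> far j. bad z}) \<le> ennreal (K * (1 / s) ^ j)"
    using pull_bad_le[OF m] by metis
  have geo: "norm (1 / s) < 1" using s_gt_1 by simp
  define K2 where "K2 = K * (1 / (1 - 1 / s))"
  have K2: "K2 > 0" unfolding K2_def using K(1) s_gt_1 by simp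
  have "eventually (\<lambda>j. C * s ^ (6 * j) + K2 < s ^ (8 * j) / 4) sequentially"
    using s_gt_1 C(1) by real_asymp
  then have "eventually (\<lambda>j. C * s ^ (6 * j) + K2 < s ^ (8 * j) / 4 \<and> j \<ge> m) sequentially"
    using eventually_ge_at_top[of m] by eventually_elim auto
  then obtain j where j: "C * s ^ (6 * j) + K2 < s ^ (8 * j) / 4" "j \<ge> m"
    using eventually_happens'[OF sequentially_bot] by blast
  define X where "X n = {z \<in> shell j. (\<forall>i<n. \<not> bad ((\<sigma> ^^ i) z)) \<and> bad ((\<sigma> ^^ n) z)}" for n
  have X_borel: "X n \<in> sets borel" for n unfolding X_def by measurable
  have shell_far: "shell j \<subseteq> far j" using far_eq_shells[of j] by (metis UN_upper UNIV_I add.right_neutral)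
  have cover: "shell j \<subseteq> persistent j \<union> (\<Union>n. X n)"
  proof
    fix z assume z: "z \<in> shell j"
    show "z \<in> persistent j \<union> (\<Union>n. X n)"
    proof (cases "\<exists>n. bad ((\<sigma> ^^ n) z)")
      case True
      then have "bad ((\<sigma> ^^ (LEAST n. bad ((\<sigma> ^^ n) z))) z)" by (rule LeastI_ex)
      then have "z \<in> X (LEAST n. bad ((\<sigma> ^^ n) z))" using z not_less_Least by (auto simp: X_def)
      then show ?thesis by blast
    qed (use z in \<open>auto simp: persistent_def\<close>)
  qed
  have X_Suc: "emeasure lborel (X (Suc n)) \<le> ennreal (K * (1 / s) ^ n)" for n
  proof -
    define E where "E = {z \<in> far (j + Suc n). bad z}"
    have E: "E \<in> sets borel" unfolding E_def by measurable
    have P: "pull (2 ^ m) E \<in> sets borel" "pull (2 ^ m) E \<subseteq> far m" using E by (auto simp: pull_def far_def)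
    have "X (Suc n) \<subseteq> (pull (2 ^ m) ^^ Suc n) E"
    proof
      fix z assume z: "z \<in> X (Suc n)"
      then have zj: "z \<in> far j" using shell_far by (auto simp: X_def)
      show "z \<in> (pull (2 ^ m) ^^ Suc n) E"
      proof (rule pull_iterateI)
        fix i assume i: "i < Suc n"
        have "(\<sigma> ^^ i) z \<in> far (j + i)"
          using z i by (intro orbit_growth[OF m j(2) zj]) (auto simp: X_def)
        moreover have "(2::real) ^ m \<le> 2 ^ (j + i)" using j by (intro power_increasing) auto
        ultimately have "2 ^ m \<le> cmod ((\<sigma> ^^ i) z)" unfolding far_def mem_Collect_eq by linarith
        then show "2 ^ m \<le> cmod ((\<sigma> ^^ i) z) \<and> \<not> bad ((\<sigma> ^^ i) z)"
          using z i by (auto simp: X_def)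
      next
        have "(\<sigma> ^^ Suc n) z \<in> far (j + Suc n)"
          using z by (intro orbit_growth[OF m j(2) zj]) (auto simp: X_def)
        then show "(\<sigma> ^^ Suc n) z \<in> E" using z by (auto simp: X_def E_def)
      qed
    qed
    also have "(pull (2 ^ m) ^^ Suc n) E = (pull (2 ^ m) ^^ n) (pull (2 ^ m) E)" by (simp add: funpow_swap1)
    finally have "emeasure lborel (X (Suc n)) \<le> emeasure lborel ((pull (2 ^ m) ^^ n) (pull (2 ^ m) E))"
      using pull_iterate_le[OF m P, of n] by (intro emeasure_mono) auto
    also have "\<dots> \<le> emeasure lborel (pull (2 ^ m) E)" using pull_iterate_le[OF m P, of n] by blast
    also have "\<dots> \<le> ennreal (K * (1 / s) ^ (j + Suc n))" unfolding E_def using j by (intro K) auto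
    also have "\<dots> \<le> ennreal (K * (1 / s) ^ n)"
      using K(1) s_gt_1 by (intro ennreal_leI mult_left_mono power_decreasing) auto
    finally show ?thesis .
  qed
  have "(\<Sum>n. emeasure lborel (X n)) = emeasure lborel (X 0) + (\<Sum>n. emeasure lborel (X (Suc n)))"
    using suminf_offset[of "\<lambda>n. emeasure lborel (X n)" 1] by simp
  also have "\<dots> \<le> ennreal (C * s ^ (6 * j)) + (\<Sum>n. ennreal (K * (1 / s) ^ n))"
    using C(2)[of j] by (intro add_mono suminf_le X_Suc) (auto simp: X_def)
  also have "(\<Sum>n. ennreal (K * (1 / s) ^ n)) = ennreal (\<Sum>n. K * (1 / s) ^ n)"
    using K(1) s_gt_1 geo by (intro suminf_ennreal2 summable_mult summable_geometric) auto
  also have "(\<Sum>n. K * (1 / s) ^ n) = K2"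
    unfolding K2_def by (simp only: suminf_mult[OF summable_geometric[OF geo]] suminf_geometric[OF geo])
  also have "ennreal (C * s ^ (6 * j)) + ennreal K2 = ennreal (C * s ^ (6 * j) + K2)"
    using C(1) K2 s_gt_1 by (intro ennreal_plus[symmetric]) auto
  also have "\<dots> < ennreal (s ^ (8 * j) / 4)" using s_gt_1 by (intro ennreal_lessI j) auto
  also have "\<dots> \<le> emeasure lborel (shell j)" by (rule shell_area)
  finally have less: "(\<Sum>n. emeasure lborel (X n)) < emeasure lborel (shell j)" .
  have "emeasure lborel (persistent j) > 0"
  proof (rule ccontr)
    assume "\<not> emeasure lborel (persistent j) > 0"
    then have zero: "emeasure lborel (persistent j) = 0" by simp
    have "emeasure lborel (shell j) \<le> emeasure lborel (persistent j \<union> (\<Union>n. X n))"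
      using X_borel by (intro emeasure_mono cover) auto
    also have "\<dots> \<le> emeasure lborel (persistent j) + emeasure lborel (\<Union>n. X n)"
      using X_borel by (intro emeasure_subadditive) auto
    also have "\<dots> \<le> 0 + (\<Sum>n. emeasure lborel (X n))"
      unfolding zero using X_borel by (intro add_left_mono emeasure_subadditive_countably) auto
    finally show False using less by simp
  qed
  with j(2) that show ?thesis by blast
qed

end

section \<open>Membership in the Julia set and in the fast escaping set\<close>

lemma two_power_exceeds: "\<exists>N. \<forall>n\<ge>N. (B::real) < 2 ^ n"
proof -
  obtain N where N: "B < 2 ^ N" using real_arch_pow[of 2 B] by auto
  have "B < 2 ^ n" if "n \<ge> N" for n
  proof -
    have "(2::real) ^ N \<le> 2 ^ n" using that by (intro power_increasing) auto
    with N show ?thesis by linarith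
  qed
  then show ?thesis by blast
qed

lemma borel_julia: "julia_set f \<in> sets borel"
proof -
  have "{z. \<exists>U. open U \<and> connected U \<and> z \<in> U \<and> normal_family_on (range (\<lambda>n::nat. f ^^ n)) U} =
     \<Union>{U. open U \<and> connected U \<and> normal_family_on (range (\<lambda>n::nat. f ^^ n)) U}" by auto
  also have "open \<dots>" by (intro open_Union) auto
  finally show ?thesis unfolding julia_set_def by auto
qed

context positive_lattice begin

lemma persistent_orbit:
  assumes m: "contracting_from m" and j: "j \<ge> m" and z: "z \<in> persistent j"
  shows "2 ^ (j + n) \<le> cmod ((\<sigma> ^^ n) z)"
    and "exp (a / 4 * cmod ((\<sigma> ^^ n) z)) \<le> cmod ((\<sigma> ^^ Suc n) z)"
    and "2 * cmod ((\<sigma> ^^ n) z) \<le> cmod ((\<sigma> ^^ Suc n) z)"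
    and "cmod ((\<sigma> ^^ Suc n) z) \<le> cmod (deriv \<sigma> ((\<sigma> ^^ n) z))"
proof -
  have far: "z \<in> far j" and good: "\<And>i. \<not> bad ((\<sigma> ^^ i) z)"
    using z by (auto simp: persistent_def shell_def far_def)
  show 1: "2 ^ (j + n) \<le> cmod ((\<sigma> ^^ n) z)" for n
    using orbit_growth[OF m j far] good by (simp add: far_def)
  have "(2::real) ^ m \<le> 2 ^ (j + n)" using j by (intro power_increasing) auto
  with 1[of n] have "2 ^ m \<le> cmod ((\<sigma> ^^ n) z)" by linarith
  from contracting_from_expanding[OF m this good]
  show "exp (a / 4 * cmod ((\<sigma> ^^ n) z)) \<le> cmod ((\<sigma> ^^ Suc n) z)"
    "2 * cmod ((\<sigma> ^^ n) z) \<le> cmod ((\<sigma> ^^ Suc n) z)"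
    "cmod ((\<sigma> ^^ Suc n) z) \<le> cmod (deriv \<sigma> ((\<sigma> ^^ n) z))" by simp_all
qed

lemma funpow_sigma_holomorphic: "(\<sigma> ^^ n) holomorphic_on UNIV"
proof (induction n)
  case (Suc n)
  then show ?case unfolding funpow.simps by (intro holomorphic_on_compose sigma_holomorphic)
qed (simp add: id_def)

lemma deriv_funpow_Suc: "deriv (\<sigma> ^^ Suc n) z = deriv \<sigma> ((\<sigma> ^^ n) z) * deriv (\<sigma> ^^ n) z"
proof -
  have "((\<sigma> ^^ n) has_field_derivative deriv (\<sigma> ^^ n) z) (at z)"
    by (rule holomorphic_derivI[OF funpow_sigma_holomorphic open_UNIV UNIV_I])
  then have "((\<lambda>z. \<sigma> ((\<sigma> ^^ n) z)) has_field_derivative deriv \<sigma> ((\<sigma> ^^ n) z) * deriv (\<sigma> ^^ n) z) (at z)"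
    by (rule DERIV_chain2[OF sigma_field_derivative])
  then show ?thesis by (intro DERIV_imp_deriv) (simp only: funpow.simps o_def)
qed

lemma persistent_derivative:
  assumes "contracting_from m" "j \<ge> m" "z \<in> persistent j"
  shows "2 ^ n \<le> cmod (deriv (\<sigma> ^^ n) z)"
proof (induction n)
  case 0
  then show ?case by (simp add: id_def)
next
  case (Suc n)
  note orb = persistent_orbit[OF assms, of n]
  have "(1::real) \<le> 2 ^ (j + n)" by simp
  then have "1 \<le> cmod ((\<sigma> ^^ n) z)" using orb(1) by linarith
  then have "2 \<le> cmod (deriv \<sigma> ((\<sigma> ^^ n) z))" using orb(3,4) by linarith
  then have "2 * 2 ^ n \<le> cmod (deriv \<sigma> ((\<sigma> ^^ n) z)) * cmod (deriv (\<sigma> ^^ n) z)"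
    using Suc by (intro mult_mono) auto
  then show ?case unfolding deriv_funpow_Suc norm_mult power_Suc .
qed

lemma large_disc_meets_lattice: "\<exists>D. \<forall>b. \<exists>w\<in>\<Lambda>. w \<in> ball b D"
proof -
  obtain D where D: "\<And>x. x \<in> cell \<Longrightarrow> cmod x < D"
    using compact_imp_bounded[OF compact_cell] by (auto simp: bounded_pos_less)
  have "\<exists>w\<in>\<Lambda>. w \<in> ball b D" for b
  proof -
    obtain w where "w \<in> \<Lambda>" "b - w \<in> cell" by (rule cell_cover)
    then show ?thesis using D by (auto simp: dist_norm)
  qed
  then show ?thesis by blast
qed

text \<open>
  Suppose that the iterates are normal near z. A finite limit is impossible because the orbit of z
  tends to infinity. A subsequence tending to infinity uniformly on a disc is impossible because, by
  Bloch's theorem, the image of the disc under a high iterate contains a lattice point, where \<sigma> vanishes.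
\<close>
lemma persistent_subset_julia:
  assumes m: "contracting_from m" and j: "j \<ge> m"
  shows "persistent j \<subseteq> julia_set \<sigma>"
proof
  fix z assume z: "z \<in> persistent j"
  note orb = persistent_orbit[OF m j z]
  have large: "\<exists>N. \<forall>n\<ge>N. B < cmod ((\<sigma> ^^ n) z)" for B
  proof -
    obtain N where N: "\<And>n. n \<ge> N \<Longrightarrow> B < 2 ^ n" using two_power_exceeds[of B] by blast
    have "B < cmod ((\<sigma> ^^ n) z)" if "n \<ge> N" for n
    proof -
      have "B < 2 ^ (j + n)" using that by (intro N) simp
      with orb(1)[of n] show ?thesis by linarith
    qed
    then show ?thesis by blast
  qed
  show "z \<in> julia_set \<sigma>"
  proof (rule ccontr)
    assume "z \<notin> julia_set \<sigma>"
    then obtain U where U: "open U" "z \<in> U" "normal_family_on (range (\<lambda>n::nat. \<sigma> ^^ n)) U"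
      unfolding julia_set_def Compl_iff mem_Collect_eq not_not by (elim exE conjE)
    have "\<forall>n. (\<sigma> ^^ n) \<in> range (\<lambda>n::nat. \<sigma> ^^ n)" by (intro allI rangeI)
    from U(3)[unfolded normal_family_on_def, THEN spec, THEN mp, OF this]
    obtain r :: "nat \<Rightarrow> nat" where r: "strict_mono r" and
      alt: "(\<exists>h. \<forall>K. compact K \<and> K \<subseteq> U \<longrightarrow> uniform_limit K ((\<lambda>n. \<sigma> ^^ n) \<circ> r) h sequentially) \<or>
        (\<forall>K. compact K \<and> K \<subseteq> U \<longrightarrow> (\<forall>B. \<forall>\<^sub>F n in sequentially. \<forall>z\<in>K. B \<le> cmod (((\<lambda>n. \<sigma> ^^ n) \<circ> r) n z)))"
      by (elim exE conjE)
    have r_ge: "n \<le> r n" for n using strict_mono_imp_increasing[OF r] .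
    from alt show False
    proof
      assume "\<exists>h. \<forall>K. compact K \<and> K \<subseteq> U \<longrightarrow> uniform_limit K ((\<lambda>n. \<sigma> ^^ n) \<circ> r) h sequentially"
      then obtain h where lim: "\<forall>K. compact K \<and> K \<subseteq> U \<longrightarrow> uniform_limit K ((\<lambda>n. \<sigma> ^^ n) \<circ> r) h sequentially" ..
      have "compact {z} \<and> {z} \<subseteq> U" using U(2) by simp
      from lim[THEN spec, THEN mp, OF this]
      have "uniform_limit {z} ((\<lambda>n. \<sigma> ^^ n) \<circ> r) h sequentially" .
      from tendsto_uniform_limitI[OF this singletonI]
      have "((\<lambda>n. (\<sigma> ^^ r n) z) \<longlongrightarrow> h z) sequentially" by (simp only: o_apply)
      then have "\<forall>\<^sub>F n in sequentially. dist ((\<sigma> ^^ r n) z) (h z) < 1" by (rule tendstoD) simp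
      then obtain N1 where N1: "\<And>n. n \<ge> N1 \<Longrightarrow> dist ((\<sigma> ^^ r n) z) (h z) < 1"
        unfolding eventually_sequentially by blast
      obtain N2 where N2: "\<And>n. n \<ge> N2 \<Longrightarrow> cmod (h z) + 1 < cmod ((\<sigma> ^^ n) z)" using large by blast
      define n where "n = max N1 N2"
      have "dist ((\<sigma> ^^ r n) z) (h z) < 1" by (rule N1) (simp add: n_def)
      moreover have "cmod (h z) + 1 < cmod ((\<sigma> ^^ r n) z)" using r_ge[of n] by (intro N2) (simp add: n_def)
      moreover have "cmod ((\<sigma> ^^ r n) z) \<le> cmod (h z) + dist ((\<sigma> ^^ r n) z) (h z)"
        using norm_triangle_ineq[of "h z" "(\<sigma> ^^ r n) z - h z"] by (simp add: dist_norm)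
      ultimately show False by linarith
    next
      assume inf: "\<forall>K. compact K \<and> K \<subseteq> U \<longrightarrow> (\<forall>B. \<forall>\<^sub>F n in sequentially. \<forall>z\<in>K. B \<le> cmod (((\<lambda>n. \<sigma> ^^ n) \<circ> r) n z))"
      obtain \<rho> where \<rho>: "\<rho> > 0" "cball z \<rho> \<subseteq> U" using open_contains_cball U(1,2) by blast
      have "\<forall>\<^sub>F n in sequentially. \<forall>x\<in>cball z \<rho>. 1 \<le> cmod ((\<sigma> ^^ r n) x)"
        using inf[THEN spec, THEN mp, OF conjI[OF compact_cball \<rho>(2)], THEN spec, of 1] by (simp only: o_apply)
      then obtain N1 where N1: "\<And>n x. n \<ge> N1 \<Longrightarrow> x \<in> cball z \<rho> \<Longrightarrow> 1 \<le> cmod ((\<sigma> ^^ r n) x)"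
        unfolding eventually_sequentially by blast
      obtain D where D: "\<And>b. \<exists>w\<in>\<Lambda>. w \<in> ball b D" using large_disc_meets_lattice by blast
      obtain N2 where N2: "\<And>n. n \<ge> N2 \<Longrightarrow> 12 * D / \<rho> < 2 ^ n" using two_power_exceeds by blast
      define k where "k = r (max N1 (Suc N2))"
      have k: "k \<ge> Suc N2" using r_ge[of "max N1 (Suc N2)"] by (simp add: k_def)
      then obtain n where n: "k = Suc n" "n \<ge> N2" by (cases k) auto
      have "12 * D / \<rho> < cmod (deriv (\<sigma> ^^ n) z)"
        using N2[OF n(2)] persistent_derivative[OF m j z, of n] by linarith
      then have "D \<le> \<rho> * cmod (deriv (\<sigma> ^^ n) z) / 12" using \<rho>(1) by (simp add: field_simps)
      then obtain b where b: "ball b D \<subseteq> (\<sigma> ^^ n) ` ball z \<rho>"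
        using Bloch[OF holomorphic_on_subset[OF funpow_sigma_holomorphic] \<rho>(1)] by blast
      obtain w where w: "w \<in> \<Lambda>" "w \<in> ball b D" using D by blast
      then obtain x where x: "x \<in> ball z \<rho>" "w = (\<sigma> ^^ n) x" using b by blast
      have "(\<sigma> ^^ k) x = 0" using w(1) x(2) sigma_eq_0_iff by (simp add: n)
      moreover have "1 \<le> cmod ((\<sigma> ^^ k) x)" unfolding k_def using x(1) by (intro N1) auto
      ultimately show False by simp
    qed
  qed
qed

text \<open>
  Compare x(n + 1) \<ge> exp(b x(n)) along the orbit with y(n + 1) \<le> exp(B y(n)^2) for the iterated maximum
  modulus. For a suitable constant K the inequality K y^2 \<le> x propagates, since K exp(2 B y^2) \<le> exp(b K y^2) for
  y \<ge> 1. It holds for y(0) as soon as x has been iterated L times.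
\<close>
lemma persistent_subset_fast_escaping:
  assumes m: "contracting_from m" and j: "j \<ge> m"
  shows "persistent j \<subseteq> fast_escaping_set \<sigma>"
proof
  fix z assume z: "z \<in> persistent j"
  note orb = persistent_orbit[OF m j z]
  define x where "x n = cmod ((\<sigma> ^^ n) z)" for n
  define R where "R = x 0"
  have R1: "R \<ge> 1" 
  proof -
    have "(1::real) \<le> 2 ^ (j + 0)" by simp
    with orb(1)[of 0] show ?thesis unfolding R_def x_def by linarith
  qed
  \<comment> \<open>The quotient of the maximum modulus by the radius is the maximum modulus of h, which increases with
    the radius, and |h| is at least 2 at the starting point. So R = |z| is admissible.\<close>
  have hz: "2 \<le> cmod (h z)"
  proof -
    have "2 * cmod z \<le> cmod z * cmod (h z)" using orb(3)[of 0] by (simp add: sigma_eq norm_mult)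
    moreover have "cmod z > 0" using R1 unfolding R_def x_def funpow_0 by linarith
    ultimately show ?thesis by (metis mult.commute mult_le_cancel_left_pos)
  qed
  have adm: "admissible_radius \<sigma> R"
    unfolding admissible_radius_def
  proof (intro conjI allI impI)
    fix t assume t: "R \<le> t"
    then have t1: "t \<ge> 1" using R1 by simp
    have "2 \<le> max_modulus h t"
      using cmod_le_max_modulus[OF h_holomorphic, of z t] hz t by (simp add: R_def x_def)
    moreover obtain w where w: "cmod w = t" "max_modulus h t = cmod (h w)"
      using max_modulus_attained[OF h_holomorphic, of t] t1 by auto
    ultimately have "t * 2 \<le> cmod (\<sigma> w)" using t1 by (simp add: sigma_eq norm_mult)
    also have "\<dots> \<le> max_modulus \<sigma> t" using cmod_le_max_modulus[OF sigma_holomorphic, of w t] w by simp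
    finally show "t < max_modulus \<sigma> t" using t1 by simp
  qed (use R1 in simp)
  define y where "y n = (max_modulus \<sigma> ^^ n) R" for n
  have y1: "y n \<ge> 1" for n using max_modulus_iterate_ge(1)[OF sigma_holomorphic adm, of n] R1 by (simp add: y_def)
  obtain c C where C: "C > 0" "\<And>z. cmod (\<sigma> z) \<le> C * exp (Q z)" using growth_bounds by metis
  define B where "B = a + \<bar>ln C\<bar>"
  have B: "B > 0" using a_pos by (simp add: B_def add_pos_nonneg)
  have y_Suc: "y (Suc n) \<le> exp (B * (y n)\<^sup>2)" for n
  proof -
    obtain w where w: "cmod w = y n" "max_modulus \<sigma> (y n) = cmod (\<sigma> w)"
      using max_modulus_attained[OF sigma_holomorphic, of "y n"] y1[of n] by auto
    have "y (Suc n) = cmod (\<sigma> w)" using w by (simp add: y_def)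
    also have "\<dots> \<le> C * exp (Q w)" by (rule C)
    also have "\<dots> = exp (ln C + Q w)" using C(1) by (simp add: exp_add)
    also have "\<dots> \<le> exp (B * (y n)\<^sup>2)"
    proof -
      have "\<bar>ln C\<bar> * 1 \<le> \<bar>ln C\<bar> * (y n)\<^sup>2" using y1[of n] by (intro mult_left_mono) auto
      moreover have "Q w \<le> a * (y n)\<^sup>2" using Q_upper[of w] w by simp
      ultimately show ?thesis unfolding B_def by (simp add: distrib_right)
    qed
    finally show ?thesis .
  qed
  define b where "b = a / 4"
  have b: "b > 0" using a_pos by (simp add: b_def)
  have x_Suc: "exp (b * x n) \<le> x (Suc n)" for n using orb(2)[of n] by (simp add: x_def b_def)
  have "eventually (\<lambda>K::real. ln K + 2 * B \<le> b * K) at_top" using b by real_asymp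
  then have "eventually (\<lambda>K::real. ln K + 2 * B \<le> b * K \<and> K \<ge> 1) at_top"
    using eventually_ge_at_top[of 1] by eventually_elim auto
  then obtain K :: real where K: "ln K + 2 * B \<le> b * K" "K \<ge> 1"
    using eventually_happens'[OF trivial_limit_at_top_linorder] by blast
  obtain L where L: "K * R\<^sup>2 < 2 ^ L" using two_power_exceeds by blast
  have main: "K * (y n)\<^sup>2 \<le> x (L + n)" for n
  proof (induction n)
    case 0
    have "(2::real) ^ L \<le> 2 ^ (j + L)" by (intro power_increasing) auto
    with L orb(1)[of L] have "K * R\<^sup>2 \<le> cmod ((\<sigma> ^^ L) z)" by linarith
    then show ?case by (simp only: y_def x_def funpow_0 add_0_right)
  next
    case (Suc n)
    have "(y (Suc n))\<^sup>2 \<le> (exp (B * (y n)\<^sup>2))\<^sup>2"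
      using y1[of "Suc n"] by (intro power_mono y_Suc) auto
    also have "\<dots> = exp (2 * B * (y n)\<^sup>2)" using exp_of_nat_mult[of 2 "B * (y n)\<^sup>2"] by (simp add: mult.assoc)
    finally have "K * (y (Suc n))\<^sup>2 \<le> K * exp (2 * B * (y n)\<^sup>2)" using K by (intro mult_left_mono) auto
    also have "\<dots> = exp (ln K + 2 * B * (y n)\<^sup>2)" using K by (simp add: exp_add)
    also have "\<dots> \<le> exp (b * (K * (y n)\<^sup>2))"
    proof -
      have "ln K * 1 \<le> ln K * (y n)\<^sup>2" using y1[of n] K by (intro mult_left_mono) auto
      moreover have "(ln K + 2 * B) * (y n)\<^sup>2 \<le> (b * K) * (y n)\<^sup>2" by (intro mult_right_mono K) auto
      ultimately show ?thesis by (simp add: distrib_right mult.assoc)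
    qed
    also have "\<dots> \<le> exp (b * x (L + n))" using Suc b by simp
    also have "\<dots> \<le> x (L + Suc n)" using x_Suc[of "L + n"] by simp
    finally show ?case .
  qed
  have "z \<in> fast_escaping_set_from \<sigma> R"
    unfolding fast_escaping_set_from_def
  proof (intro CollectI exI[of _ L] allI impI)
    fix n assume n: "L < n"
    have "y (n - L) * 1 \<le> y (n - L) * y (n - L)" using y1[of "n - L"] by (intro mult_left_mono) auto
    also have "\<dots> = 1 * (y (n - L))\<^sup>2" by (simp add: power2_eq_square)
    also have "\<dots> \<le> K * (y (n - L))\<^sup>2" using K by (intro mult_right_mono) auto
    also have "\<dots> \<le> x (L + (n - L))" by (rule main)
    finally show "(max_modulus \<sigma> ^^ (n - L)) R \<le> cmod ((\<sigma> ^^ n) z)" using n by (simp add: y_def x_def)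
  qed
  then show "z \<in> fast_escaping_set \<sigma>" using adm by (auto simp: fast_escaping_set_def)
qed

lemma borel_fast_escaping: "fast_escaping_set \<sigma> \<in> sets borel"
proof (cases "\<exists>R. admissible_radius \<sigma> R")
  case True
  then obtain R where R: "admissible_radius \<sigma> R" by blast
  have [measurable]: "(\<lambda>z. (\<sigma> ^^ n) z) \<in> borel_measurable borel" for n
    using measurable_sigma_funpow by simp
  have "fast_escaping_set_from \<sigma> R \<in> sets borel"
    unfolding fast_escaping_set_from_def by measurable
  then show ?thesis using fast_escaping_set_eq[OF sigma_holomorphic R] by simp
next
  case False
  then have "Collect (admissible_radius \<sigma>) = {}" by blast
  then show ?thesis by (simp only: fast_escaping_set_def UN_empty sets.empty_sets)
qed

lemma julia_fast_escaping_positive: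
  "emeasure lebesgue (julia_set \<sigma> \<inter> fast_escaping_set \<sigma>) > 0"
proof -
  obtain m where m: "contracting_from m" using contracting_from_exists by blast
  obtain j where j: "j \<ge> m" "emeasure lborel (persistent j) > 0" using persistent_positive[OF m] .
  have "emeasure lborel (persistent j) = emeasure lebesgue (persistent j)" by simp
  also have "\<dots> \<le> emeasure lebesgue (julia_set \<sigma> \<inter> fast_escaping_set \<sigma>)"
    using persistent_subset_julia[OF m j(1)] persistent_subset_fast_escaping[OF m j(1)]
      borel_julia[of \<sigma>] borel_fast_escaping by (intro emeasure_mono) auto
  finally show ?thesis using j(2) by (rule less_le_trans[rotated])
qed

end

theorem theorem1p7:
  fixes \<tau> \<eta>1 :: complex and \<sigma> \<zeta> :: "complex \<Rightarrow> complex"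
  assumes "Im \<tau> > 0"
    and "\<sigma> = weierstrass_sigma 1 \<tau>"
    and "\<zeta> = weierstrass_zeta 1 \<tau>"
    and "\<eta>1 = 2 * \<zeta> (1 / 2)"
    and "Re (1 / \<eta>1) \<ge> Im \<tau> / (2 * pi)"
  shows "emeasure lebesgue (julia_set \<sigma> \<inter> fast_escaping_set \<sigma>) > 0"
proof -
  interpret positive_lattice \<tau> using assms by unfold_locales auto
  show ?thesis unfolding assms(2) by (rule julia_fast_escaping_positive)
qed

end
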